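(* Fix an integer $d\ge 2$. Consider a family of local quantum circuits with charge conservation (as defined in the context) on chains of $N$ qudits of local dimension $d$, where $N$ ranges over even positive integers, and write $U(t,0)$, $t\in\mathbb Z^+$, for the time-evolution operator of a circuit in the family. Suppose that charge transport under the dynamics $U(t,0)$ is not faster than diffusive, in the sense of the no-faster-than-diffusive condition stated in the context, with constants uniform over the family. View the chain of $N$ qudits as a bipartite system $A\otimes B$, where $A$ consists of the qudits at sites $1,2,\ldots,N/2$ and $B$ is the rest. Initialize the system in a random product state $|\psi_{\rm ini}\rangle$ in the generalized Pauli $X$ basis, i.e., the state of each qudit is chosen independently and uniformly at random from the eigenbasis $\{|0),|1),\ldots,|d-1)\}$ of the generalized Pauli $X$ operator. Let $$\rho_A(t):=\operatorname{tr}_B\left(U(t,0)|\psi_{\rm ini}\rangle\langle\psi_{\rm ini}|U^\dagger(t,0)\right).$$ Then, for every $\alpha>1$, $$R_\alpha(\rho_A(t))=\frac{\alpha}{\alpha-1}\,O\left(\sqrt{t\log t}\right)$$ holds with probability at least $1-1/p(t)$ over the choice of $|\psi_{\rm ini}\rangle$, where $p$ is a polynomial of arbitrarily high degree. Explicitly: for every real polynomial $p$ with $p(t)>0$ for all $t\ge1$, there exist constants $M,t_0>0$ (depending only on $d$, $p$, and the constants in the no-faster-than-diffusive condition) such that for every circuit in the family, every $\alpha>1$ and every integer $t>t_0$, $$\Pr_{|\psi_{\rm ini}\rangle}\left(R_\alpha(\rho_A(t))\le\frac{\alpha}{\alpha-1}\,M\sqrt{t\log t}\right)\ge1-\frac{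1}{p(t)}.$$
   Context: Logarithms are to an arbitrary fixed base greater than $1$. Rényi entanglement entropy. For $\alpha\in(0,1)\cup(1,\infty)$ and a reduced density matrix $\rho_A=\operatorname{tr}_B\rho_{AB}$ of a bipartite pure state $\rho_{AB}$, $R_\alpha(\rho_A):=\frac{1}{1-\alpha}\log\operatorname{tr}(\rho_A^\alpha)$. Spin, charge and generalized Pauli operators. Each site $i\in\{1,\ldots,N\}$ carries a copy of $\mathbb C^d$ with orthonormal basis $|0\rangle_i,\ldots,|d-1\rangle_i$ (the computational basis). The $z$ component of the spin operator is $S_i^z|k\rangle_i=((d-1)/2-k)|k\rangle_i$, the charge operator is $Q_i:=(d-1)/2-S_i^z$, so that $Q_i|k\rangle_i=k|k\rangle_i$. The generalized Pauli $X$ operator is $X_i|k\rangle_i=|(k+1)\bmod d\rangle_i$; its orthonormal eigenbasis is denoted $\{|0)_i,\ldots,|d-1)_i\}$ and satisfies $|\langle k|k')|=1/\sqrt d$ for all $k,k'$. Local quantum circuit with charge conservation. On a chain of $N$ qudits ($N$ even), the time-evolution operator is $U(t,0)=U(t,t-1)U(t-1,t-2)\cdots U(1,0)$ for $t\in\mathbb Z^+$, where each layer is $$U(t,t-1)=\prod_{i=1}^{N/2-1}U^{(t)}_{2i,2i+1}\times\prod_{i=1}^{N/2}U^{(t)}_{2i-1,2i},$$ and each $U^{(t)}_{i,i+1}$ is a unitary acting on the two neighboring sites $i,i+1$ and commuting with $S_i^z+S_{i+1}^z$. No-faster-than-diffusive condition. Divide the chain of $N$ qudits into $C\otimes D$,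 where $C$ is a contiguous region of $m$ qudits and $D$ is the rest. Initialize $C$ in the state $|0\rangle^{\otimes m}$ and $D$ in an arbitrary (normalized) product state, i.e., each qudit in $D$ is disentangled from all other qudits. Let $i$ be the position of a qudit in the bulk of $C$, meaning that the distances from site $i$ to the two endpoints of $C$ are both $\Theta(m)$. Then $\langle\psi(t)|Q_i|\psi(t)\rangle=e^{-\Omega(m^2/t)}$, where $|\psi(t)\rangle=U(t,0)|\psi(0)\rangle$ is the state at time $t$. Explicitly: for every $\delta\in(0,1/2)$ there exist constants $c,x_0>0$ such that for every circuit in the family, every contiguous region $C$ of $m$ sites, every site $i\in C$ at distance at least $\delta m$ from both endpoints of $C$, every initial state $|\psi(0)\rangle=|0\rangle^{\otimes m}_C\otimes|\phi\rangle_D$ with $|\phi\rangle_D$ a normalized product state of the qudits in $D$, and every $t\in\mathbb Z^+$ with $m^2/t>x_0$, one has $\langle\psi(t)|Q_i|\psi(t)\rangle\le e^{-c\,m^2/t}$. *)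

theory Defs
  imports
    "HOL-Probability.Product_PMF"
    "HOL-Computational_Algebra.Polynomial"
    "Jordan_Normal_Form.Schur_Decomposition"
begin

unbundle no vec_syntax
no_notation inner (infix "\<bullet>" 70)

definition unitary_mat :: "nat \<Rightarrow> complex mat \<Rightarrow> bool" where
  "unitary_mat n U \<longleftrightarrow>
     U \<in> carrier_mat n n \<and> U * mat_adjoint U = 1\<^sub>m n \<and> mat_adjoint U * U = 1\<^sub>m n"

definition mat_trace :: "complex mat \<Rightarrow> complex" where
  "mat_trace A = (\<Sum>i<dim_row A. A $$ (i, i))"

text \<open>Real power of a positive semidefinite matrix by functional calculus. The value does not
  depend on the spectral decomposition that is picked; \<open>0 powr s = 0\<close>.\<close>

definition mat_powr :: "complex mat \<Rightarrow> real \<Rightarrow> complex mat" where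
  "mat_powr A s = (let n = dim_row A in
     SOME R. \<exists>V ev. unitary_mat n V \<and> (\<forall>i<n. 0 \<le> ev i) \<and>
       A = V * mat_diag n (\<lambda>i. complex_of_real (ev i)) * mat_adjoint V \<and>
       R = V * mat_diag n (\<lambda>i. complex_of_real (ev i powr s)) * mat_adjoint V)"

definition renyi :: "real \<Rightarrow> real \<Rightarrow> complex mat \<Rightarrow> real" where
  "renyi b \<alpha> \<rho> = 1 / (1 - \<alpha>) * log b (Re (mat_trace (mat_powr \<rho> \<alpha>)))"

definition ket_bra :: "complex vec \<Rightarrow> complex mat" where
  "ket_bra \<psi> = Matrix.mat (dim_vec \<psi>) (dim_vec \<psi>) (\<lambda>(x, y). \<psi> $ x * cnj (\<psi> $ y))"

text \<open>The chain of \<open>N\<close> qudits lives on \<open>complex vec\<close>s of dimension \<open>d ^ N\<close>. An index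
  \<open>x < d ^ N\<close> stands for the computational basis state whose site \<open>i \<in> {1..N}\<close> is in the state
  \<open>|digit d N x i\<rangle>\<close>; site 1 is the most significant base-\<open>d\<close> digit.\<close>

definition digit :: "nat \<Rightarrow> nat \<Rightarrow> nat \<Rightarrow> nat \<Rightarrow> nat" where
  "digit d N x i = x div d ^ (N - i) mod d"

definition product_state :: "nat \<Rightarrow> nat \<Rightarrow> (nat \<Rightarrow> complex vec) \<Rightarrow> complex vec" where
  "product_state d N v = Matrix.vec (d ^ N) (\<lambda>x. \<Prod>i\<in>{1..N}. v i $ digit d N x i)"

definition site_op :: "nat \<Rightarrow> nat \<Rightarrow> nat \<Rightarrow> complex mat \<Rightarrow> complex mat" where
  "site_op d N i A = Matrix.mat (d ^ N) (d ^ N) (\<lambda>(x, y).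
     if \<forall>j\<in>{1..N} - {i}. digit d N x j = digit d N y j
     then A $$ (digit d N x i, digit d N y i) else 0)"

text \<open>\<open>A\<close> is a \<open>d\<^sup>2 \<times> d\<^sup>2\<close> matrix; the basis state \<open>|k\<rangle>|l\<rangle>\<close> of sites \<open>i, i + 1\<close> has index
  \<open>k * d + l\<close>.\<close>

definition bond_op :: "nat \<Rightarrow> nat \<Rightarrow> nat \<Rightarrow> complex mat \<Rightarrow> complex mat" where
  "bond_op d N i A = Matrix.mat (d ^ N) (d ^ N) (\<lambda>(x, y).
     if \<forall>j\<in>{1..N} - {i, i + 1}. digit d N x j = digit d N y j
     then A $$ (digit d N x i * d + digit d N x (i + 1), digit d N y i * d + digit d N y (i + 1))
     else 0)"

definition spin_z :: "nat \<Rightarrow> nat \<Rightarrow> nat \<Rightarrow> complex mat" where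
  "spin_z d N i =
     site_op d N i (mat_diag d (\<lambda>k. complex_of_real ((real d - 1) / 2 - real k)))"

definition charge :: "nat \<Rightarrow> nat \<Rightarrow> nat \<Rightarrow> complex mat" where
  "charge d N i = complex_of_real ((real d - 1) / 2) \<cdot>\<^sub>m 1\<^sub>m (d ^ N) - spin_z d N i"

text \<open>\<open>\<langle>\<psi>|A|\<psi>\<rangle>\<close>; this number is real for the Hermitian \<open>A\<close> it is used with.\<close>

definition expect :: "complex mat \<Rightarrow> complex vec \<Rightarrow> real" where
  "expect A \<psi> = Re ((A *\<^sub>v \<psi>) \<bullet>c \<psi>)"

definition pauli_X :: "nat \<Rightarrow> complex mat" where
  "pauli_X d = Matrix.mat d d (\<lambda>(k, l). if k = (l + 1) mod d then 1 else 0)"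

definition X_eigenbasis :: "nat \<Rightarrow> (nat \<Rightarrow> complex vec) \<Rightarrow> bool" where
  "X_eigenbasis d e \<longleftrightarrow>
     (\<forall>k<d. \<exists>\<mu>. eigenvector (pauli_X d) (e k) \<mu>) \<and>
     (\<forall>k<d. \<forall>l<d. e k \<bullet>c e l = (if k = l then 1 else 0))"

definition random_X_state :: "nat \<Rightarrow> nat \<Rightarrow> (nat \<Rightarrow> complex vec) \<Rightarrow> complex vec pmf" where
  "random_X_state d N e =
     map_pmf (\<lambda>s. product_state d N (\<lambda>i. e (s i))) (Pi_pmf {1..N} 0 (\<lambda>_. pmf_of_set {..<d}))"

text \<open>A circuit is a pair \<open>(N, G)\<close>, where \<open>G t i\<close> is the \<open>d\<^sup>2 \<times> d\<^sup>2\<close> matrix of the gate that acts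
  on sites \<open>i, i + 1\<close> in layer \<open>t\<close>. Entries outside \<open>t \<ge> 1\<close>, \<open>1 \<le> i < N\<close> are irrelevant.\<close>

type_synonym circuit = "nat \<times> (nat \<Rightarrow> nat \<Rightarrow> complex mat)"

definition charge_conserving_circuit :: "nat \<Rightarrow> circuit \<Rightarrow> bool" where
  "charge_conserving_circuit d = (\<lambda>(N, G). 0 < N \<and> even N \<and>
     (\<forall>t\<ge>1. \<forall>i\<in>{1..<N}. unitary_mat (d\<^sup>2) (G t i) \<and>
        bond_op d N i (G t i) * (spin_z d N i + spin_z d N (i + 1)) =
        (spin_z d N i + spin_z d N (i + 1)) * bond_op d N i (G t i)))"

definition mat_prod :: "nat \<Rightarrow> complex mat list \<Rightarrow> complex mat" where
  "mat_prod n As = foldr (*) As (1\<^sub>m n)"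

definition layer :: "nat \<Rightarrow> circuit \<Rightarrow> nat \<Rightarrow> complex mat" where
  "layer d = (\<lambda>(N, G) t.
     mat_prod (d ^ N) (map (\<lambda>i. bond_op d N (2 * i) (G t (2 * i))) [1..<N div 2]) *
     mat_prod (d ^ N) (map (\<lambda>i. bond_op d N (2 * i - 1) (G t (2 * i - 1))) [1..<N div 2 + 1]))"

fun evolution :: "nat \<Rightarrow> circuit \<Rightarrow> nat \<Rightarrow> complex mat" where
  "evolution d C 0 = 1\<^sub>m (d ^ fst C)"
| "evolution d C (Suc t) = layer d C (Suc t) * evolution d C t"

text \<open>Partial trace over sites \<open>N/2 + 1, \<dots>, N\<close>, i.e. over the \<open>N/2\<close> least significant digits.\<close>

definition trace_B :: "nat \<Rightarrow> nat \<Rightarrow> complex mat \<Rightarrow> complex mat" where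
  "trace_B d N \<rho> = (let D = d ^ (N div 2) in
     Matrix.mat D D (\<lambda>(x, y). \<Sum>z<D. \<rho> $$ (x * D + z, y * D + z)))"

definition rho_A :: "nat \<Rightarrow> circuit \<Rightarrow> nat \<Rightarrow> complex vec \<Rightarrow> complex mat" where
  "rho_A d C t \<psi> =
     trace_B d (fst C) (evolution d C t * ket_bra \<psi> * mat_adjoint (evolution d C t))"

text \<open>The constants of the condition are functions \<open>c, x0\<close> of \<open>\<delta>\<close>, shared by the whole family
  \<open>F\<close>. The contiguous region is \<open>{a..<a + m}\<close>, with endpoints \<open>a\<close> and \<open>a + m - 1\<close>.\<close>

definition no_faster_than_diffusive ::
    "nat \<Rightarrow> circuit set \<Rightarrow> (real \<Rightarrow> real) \<Rightarrow> (real \<Rightarrow> real) \<Rightarrow> bool" where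
  "no_faster_than_diffusive d F c x0 \<longleftrightarrow>
     (\<forall>\<delta>. 0 < \<delta> \<and> \<delta> < 1 / 2 \<longrightarrow> 0 < c \<delta> \<and> 0 < x0 \<delta> \<and>
       (\<forall>(N, G)\<in>F. \<forall>a m i v t.
          1 \<le> a \<and> 1 \<le> m \<and> a + m \<le> N + 1 \<and> i \<in> {a..<a + m} \<and>
          \<delta> * real m \<le> real i - real a \<and> \<delta> * real m \<le> real (a + m - 1) - real i \<and>
          (\<forall>j\<in>{1..N}. v j \<in> carrier_vec d \<and> v j \<bullet>c v j = 1) \<and>
          (\<forall>j\<in>{a..<a + m}. v j = unit_vec d 0) \<and>
          1 \<le> t \<and> x0 \<delta> < (real m)\<^sup>2 / real t \<longrightarrow>
          expect (charge d N i) (evolution d (N, G) t *\<^sub>v product_state d N v)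
            \<le> exp (- c \<delta> * (real m)\<^sup>2 / real t)))"

end

theory Submission
  imports Defs
begin

text \<open>
  The largest eigenvalue of \<open>\<rho>\<^sub>A\<close> is at least the squared overlap of the evolved state with any unit
  vector that is a product across the cut, and \<open>R\<^sub>\<alpha> \<le> \<alpha> / (\<alpha> - 1) * log (1 / \<lambda>\<^sub>m\<^sub>a\<^sub>x)\<close>. Let \<open>C\<close> consist of the
  \<open>2 k\<close> sites around the cut, \<open>k\<close> of order \<open>sqrt (t log t)\<close>, and let \<open>\<theta>\<close> be the initial state with
  \<open>C\<close> reset to \<open>|0\<dots>0\<rangle>\<close>; its overlap with the initial state has modulus \<open>d ^ (- k)\<close>. Diffusive transport
  keeps the two sites at the cut in \<open>|00\<rangle>\<close> up to an error that is an arbitrarily high negative power of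
  \<open>t\<close>, and by charge conservation a gate acts on \<open>|00\<rangle>\<close> as a phase. Hence \<open>U \<theta>\<close> is within \<open>\<delta>\<close> of
  \<open>U' \<theta>\<close>, where \<open>U'\<close> has the gates across the cut replaced by phases, so that \<open>U' \<theta>\<close> is a product.

  The overlap of \<open>U' \<theta>\<close> with the evolved state differs from that of \<open>\<theta>\<close> with the initial state by
  the overlap of the error vector \<open>U' \<theta> - U \<theta>\<close>, and \<open>\<delta>\<close> is not small compared to \<open>d ^ (- k)\<close>. But the
  error vector does not depend on the random labels in \<open>C\<close>, so by Bessel's inequality its mean
  squared overlap is at most \<open>\<delta>\<^sup>2 / d ^ (2 * k)\<close>, and Markov's inequality applies.
\<close>

section \<open>Complex vectors and unitary matrices\<close>

lemma dim_mat_adjoint [simp]: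
  "dim_row (mat_adjoint A) = dim_col A" "dim_col (mat_adjoint A) = dim_row A"
  by (simp_all add: mat_adjoint_def mat_of_rows_def)

lemma mat_adjoint_carrier [simp]: "A \<in> carrier_mat n m \<Longrightarrow> mat_adjoint A \<in> carrier_mat m n"
  by (metis carrier_matD carrier_matI dim_mat_adjoint)

lemma index_mat_adjoint [simp]:
  fixes A :: "complex mat"
  shows "i < dim_col A \<Longrightarrow> j < dim_row A \<Longrightarrow> mat_adjoint A $$ (i, j) = cnj (A $$ (j, i))"
  by (simp add: mat_adjoint_def mat_of_rows_def)

lemma index_mult_mat_sum:
  "i < dim_row A \<Longrightarrow> j < dim_col B \<Longrightarrow> dim_col A = dim_row B \<Longrightarrow>
    (A * B) $$ (i, j) = (\<Sum>k<dim_row B. A $$ (i, k) * B $$ (k, j))"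
  by (simp add: scalar_prod_def atLeast0LessThan)

lemma index_mult_mat_vec_sum:
  "i < dim_row A \<Longrightarrow> dim_col A = dim_vec v \<Longrightarrow>
    (A *\<^sub>v v) $ i = (\<Sum>k<dim_vec v. A $$ (i, k) * v $ k)"
  by (simp add: scalar_prod_def atLeast0LessThan)

lemma cscalar_prod_sum:
  fixes v w :: "complex vec"
  shows "v \<bullet>c w = (\<Sum>i<dim_vec w. v $ i * cnj (w $ i))"
  by (simp add: scalar_prod_def atLeast0LessThan)

lemma mat_adjoint_mult:
  fixes A B :: "complex mat"
  assumes "A \<in> carrier_mat n m" "B \<in> carrier_mat m k"
  shows "mat_adjoint (A * B) = mat_adjoint B * mat_adjoint A"
  using assms
  by (intro eq_matI) (auto simp: index_mult_mat_sum simp del: index_mult_mat(1) intro!: sum.cong)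

lemma mult_carrier_square_mat [simp]:
  "A \<in> carrier_mat n n \<Longrightarrow> B \<in> carrier_mat n n \<Longrightarrow> A * B \<in> carrier_mat n n"
  by (rule mult_carrier_mat)

lemma mult_carrier_square_mat_vec [simp]:
  "A \<in> carrier_mat n n \<Longrightarrow> v \<in> carrier_vec n \<Longrightarrow> A *\<^sub>v v \<in> carrier_vec n"
  by (rule mult_mat_vec_carrier)

lemma mat_adjoint_adjoint [simp]:
  fixes A :: "complex mat"
  shows "mat_adjoint (mat_adjoint A) = A"
  by (intro eq_matI) auto

lemma mult_mat_vec_cscalar:
  fixes A :: "complex mat"
  assumes "A \<in> carrier_mat n m" "v \<in> carrier_vec m" "w \<in> carrier_vec n"
  shows "(A *\<^sub>v v) \<bullet>c w = v \<bullet>c (mat_adjoint A *\<^sub>v w)"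
proof -
  have "(A *\<^sub>v v) \<bullet>c w = (\<Sum>i<n. \<Sum>j<m. A $$ (i, j) * v $ j * cnj (w $ i))"
    using assms by (auto simp: cscalar_prod_sum index_mult_mat_vec_sum sum_distrib_right
        simp del: index_mult_mat_vec intro!: sum.cong)
  also have "\<dots> = (\<Sum>j<m. \<Sum>i<n. A $$ (i, j) * v $ j * cnj (w $ i))"
    by (rule sum.swap)
  also have "\<dots> = v \<bullet>c (mat_adjoint A *\<^sub>v w)"
    using assms by (auto simp: cscalar_prod_sum index_mult_mat_vec_sum sum_distrib_left
        mult_ac simp del: index_mult_mat_vec intro!: sum.cong)
  finally show ?thesis .
qed

text \<open>An index below \<open>m * n\<close> is a pair of a high part \<open>u\<close> and a low
  part \<open>w\<close>. This is the tensor convention throughout: with \<open>n\<close> a power of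
  \<open>d\<close>, \<open>u\<close> describes the sites on the left and \<open>w\<close> those on
  the right.\<close>

lemma sum_lessThan_mult:
  fixes g :: "nat \<Rightarrow> 'a::comm_monoid_add"
  shows "(\<Sum>x<m * n. g x) = (\<Sum>u<m. \<Sum>w<n. g (u * n + w))"
proof -
  have "(\<Sum>w<n. g (u * n + w)) = sum g {u * n..<u * n + n}" for u
    using sum.shift_bounds_nat_ivl[of g 0 "u * n" n] by (simp add: atLeast0LessThan add.commute)
  thus ?thesis by (simp add: sum.nat_group)
qed

lemma mult_add_less: "u < (m::nat) \<Longrightarrow> w < n \<Longrightarrow> u * n + w < m * n"
proof -
  assume "u < m" "w < n"
  hence "u * n + w < Suc u * n" "Suc u * n \<le> m * n" by (auto simp del: mult_Suc intro: mult_le_mono1) simp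
  thus ?thesis by linarith
qed

text \<open>Phrased through \<open>L2_set\<close>, whose triangle and Cauchy-Schwarz inequalities
  then apply directly.\<close>

definition vnorm :: "complex vec \<Rightarrow> real" where
  "vnorm v = L2_set (\<lambda>i. cmod (v $ i)) {..<dim_vec v}"

lemma vnorm_nonneg [simp]: "0 \<le> vnorm v"
  by (simp add: vnorm_def L2_set_nonneg)

lemma vnorm_power2: "(vnorm v)\<^sup>2 = (\<Sum>i<dim_vec v. (cmod (v $ i))\<^sup>2)"
  by (simp add: vnorm_def L2_set_def sum_nonneg)

lemma cscalar_prod_self: "v \<bullet>c v = complex_of_real ((vnorm v)\<^sup>2)"
  by (simp add: cscalar_prod_sum vnorm_power2 complex_norm_square del: of_real_power)

lemma vnorm_zero [simp]: "vnorm (0\<^sub>v n) = 0"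
  by (simp add: vnorm_def L2_set_def)

lemma vnorm_add_le: "dim_vec v = dim_vec w \<Longrightarrow> vnorm (v + w) \<le> vnorm v + vnorm w"
proof -
  assume d: "dim_vec v = dim_vec w"
  have "vnorm (v + w) \<le> L2_set (\<lambda>i. cmod (v $ i) + cmod (w $ i)) {..<dim_vec w}"
    unfolding vnorm_def by (auto intro!: L2_set_mono norm_triangle_ineq simp: d)
  also have "\<dots> \<le> vnorm v + vnorm w"
    unfolding vnorm_def d by (rule L2_set_triangle_ineq)
  finally show ?thesis .
qed

lemma vnorm_minus_le: "dim_vec v = dim_vec w \<Longrightarrow> vnorm (v - w) \<le> vnorm v + vnorm w"
proof -
  assume d: "dim_vec v = dim_vec w"
  have "vnorm (v - w) \<le> L2_set (\<lambda>i. cmod (v $ i) + cmod (w $ i)) {..<dim_vec w}"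
    unfolding vnorm_def by (auto intro!: L2_set_mono norm_triangle_ineq4 simp: d)
  also have "\<dots> \<le> vnorm v + vnorm w"
    unfolding vnorm_def d by (rule L2_set_triangle_ineq)
  finally show ?thesis .
qed

lemma vnorm_smult: "vnorm (a \<cdot>\<^sub>v v) = cmod a * vnorm v"
  unfolding vnorm_def by (simp add: L2_set_right_distrib norm_mult cong: L2_set_cong_simp)

lemma cmod_sum_mult_le:
  "cmod (\<Sum>i\<in>I. f i * g i) \<le> L2_set (\<lambda>i. cmod (f i)) I * L2_set (\<lambda>i. cmod (g i)) I"
proof -
  have "cmod (\<Sum>i\<in>I. f i * g i) \<le> (\<Sum>i\<in>I. \<bar>cmod (f i)\<bar> * \<bar>cmod (g i)\<bar>)"
    by (rule order_trans[OF norm_sum]) (simp add: norm_mult)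
  also have "\<dots> \<le> L2_set (\<lambda>i. cmod (f i)) I * L2_set (\<lambda>i. cmod (g i)) I"
    by (rule L2_set_mult_ineq)
  finally show ?thesis .
qed

section \<open>Unitary matrices\<close>

lemma unitary_mat_carrier: "unitary_mat n U \<Longrightarrow> U \<in> carrier_mat n n"
  by (simp add: unitary_mat_def)

lemma unitary_matI:
  assumes "U \<in> carrier_mat n n" "mat_adjoint U * U = 1\<^sub>m n"
  shows "unitary_mat n U"
  using assms mat_mult_left_right_inverse[of "mat_adjoint U" n U] by (simp add: unitary_mat_def)

lemma unitary_mat_mult:
  assumes "unitary_mat n U" "unitary_mat n V"
  shows "unitary_mat n (U * V)"
proof (rule unitary_matI)
  have c: "U \<in> carrier_mat n n" "V \<in> carrier_mat n n"
    "mat_adjoint U \<in> carrier_mat n n" "mat_adjoint V \<in> carrier_mat n n"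
    using assms by (auto simp: unitary_mat_def)
  have "mat_adjoint (U * V) * (U * V) = mat_adjoint V * (mat_adjoint U * U) * V"
    using c by (simp add: mat_adjoint_mult[of U n n V n] assoc_mult_mat[of _ n n _ n _ n])
  also have "\<dots> = 1\<^sub>m n" using assms c by (simp add: unitary_mat_def)
  finally show "mat_adjoint (U * V) * (U * V) = 1\<^sub>m n" .
  show "U * V \<in> carrier_mat n n" using c by simp
qed

lemma mat_diag_mult_vec:
  fixes v :: "'a::semiring_0 vec"
  assumes "v \<in> carrier_vec n"
  shows "mat_diag n f *\<^sub>v v = Matrix.vec n (\<lambda>i. f i * v $ i)"
proof (rule eq_vecI)
  fix i assume "i < dim_vec (Matrix.vec n (\<lambda>i. f i * v $ i))"
  hence i: "i < n" by simp
  have "(mat_diag n f *\<^sub>v v) $ i = (\<Sum>k<n. (if i = k then f k else 0) * v $ k)"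
    using i assms by (simp add: mat_diag_def scalar_prod_def atLeast0LessThan)
  also have "\<dots> = (\<Sum>k<n. if k = i then f i * v $ i else 0)"
    by (rule sum.cong) auto
  finally have "(mat_diag n f *\<^sub>v v) $ i = (\<Sum>k<n. if k = i then f i * v $ i else 0)" .
  thus "(mat_diag n f *\<^sub>v v) $ i = Matrix.vec n (\<lambda>i. f i * v $ i) $ i" using i by simp
qed (simp add: mat_diag_def)

lemma unitary_mat_adjoint: "unitary_mat n U \<Longrightarrow> unitary_mat n (mat_adjoint U)"
  by (simp add: unitary_mat_def)

lemma unitary_mat_one: "unitary_mat n (1\<^sub>m n)"
  by (rule unitary_matI) (auto intro!: eq_matI simp: index_mult_mat_sum simp del: index_mult_mat(1))

lemma unitary_cscalar:
  assumes "unitary_mat n U" "v \<in> carrier_vec n" "w \<in> carrier_vec n"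
  shows "(U *\<^sub>v v) \<bullet>c (U *\<^sub>v w) = v \<bullet>c w"
proof -
  have c: "U \<in> carrier_mat n n" "mat_adjoint U \<in> carrier_mat n n"
    using assms by (auto simp: unitary_mat_def)
  have "(U *\<^sub>v v) \<bullet>c (U *\<^sub>v w) = v \<bullet>c (mat_adjoint U *\<^sub>v (U *\<^sub>v w))"
    using assms c by (intro mult_mat_vec_cscalar) auto
  also have "mat_adjoint U *\<^sub>v (U *\<^sub>v w) = w"
    using assms c by (simp add: assoc_mult_mat_vec[symmetric, of _ n n _ n] unitary_mat_def)
  finally show ?thesis .
qed

lemma unitary_vnorm:
  assumes "unitary_mat n U" "v \<in> carrier_vec n"
  shows "vnorm (U *\<^sub>v v) = vnorm v"
proof -
  have "complex_of_real ((vnorm (U *\<^sub>v v))\<^sup>2) = complex_of_real ((vnorm v)\<^sup>2)"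
    using unitary_cscalar[OF assms(1,2,2)] unfolding cscalar_prod_self .
  hence "(vnorm (U *\<^sub>v v))\<^sup>2 = (vnorm v)\<^sup>2" by (simp only: of_real_eq_iff)
  thus ?thesis by simp
qed

text \<open>The residual of \<open>w\<close> after orthogonal projection onto the span of the
  \<open>u k\<close> has nonnegative squared norm, and this squared norm is the right side minus the
  left side.\<close>

lemma bessel_inequality:
  fixes w :: "complex vec" and u :: "'a \<Rightarrow> complex vec"
  assumes "finite K" "w \<in> carrier_vec n" "\<And>k. k \<in> K \<Longrightarrow> u k \<in> carrier_vec n"
    and orth: "\<And>k l. k \<in> K \<Longrightarrow> l \<in> K \<Longrightarrow> u k \<bullet>c u l = (if k = l then 1 else 0)"
  shows "(\<Sum>k\<in>K. (cmod (w \<bullet>c u k))\<^sup>2) \<le> (vnorm w)\<^sup>2"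
proof -
  define c where "c k = w \<bullet>c u k" for k
  \<comment> \<open>\<open>f\<close> is the projection of \<open>w\<close>. Both cross terms and the
    squared norm of \<open>f\<close> equal \<open>S\<close>, so the expansion for
    \<open>w - f\<close> keeps a single \<open>- S\<close>.\<close>
  define f where "f i = (\<Sum>k\<in>K. c k * u k $ i)" for i
  define S where "S = (\<Sum>k\<in>K. c k * cnj (c k))"
  have ip: "v \<bullet>c u k = (\<Sum>i<n. v $ i * cnj (u k $ i))" if "k \<in> K" for k v
    using assms(3)[OF that] by (auto simp: cscalar_prod_sum)
  have wf: "(\<Sum>i<n. w $ i * cnj (f i)) = S"
  proof -
    have "(\<Sum>i<n. w $ i * cnj (f i)) = (\<Sum>i<n. \<Sum>k\<in>K. cnj (c k) * (w $ i * cnj (u k $ i)))"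
      by (simp add: f_def sum_distrib_left mult_ac)
    also have "\<dots> = (\<Sum>k\<in>K. \<Sum>i<n. cnj (c k) * (w $ i * cnj (u k $ i)))"
      by (rule sum.swap)
    also have "\<dots> = (\<Sum>k\<in>K. cnj (c k) * c k)"
      by (intro sum.cong refl) (simp only: c_def ip sum_distrib_left)
    finally show ?thesis by (simp add: S_def mult_ac)
  qed
  have fw: "(\<Sum>i<n. f i * cnj (w $ i)) = S"
    using arg_cong[OF wf, of cnj] by (simp add: S_def mult_ac)
  have ff: "(\<Sum>i<n. f i * cnj (f i)) = S"
  proof -
    have "(\<Sum>i<n. f i * cnj (f i)) =
        (\<Sum>i<n. \<Sum>k\<in>K. \<Sum>l\<in>K. c k * cnj (c l) * (u k $ i * cnj (u l $ i)))"
      by (simp add: f_def sum_product mult_ac)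
    also have "\<dots> = (\<Sum>k\<in>K. \<Sum>l\<in>K. \<Sum>i<n. c k * cnj (c l) * (u k $ i * cnj (u l $ i)))"
      unfolding sum.swap[of _ _ "{..<n}"] ..
    also have "\<dots> = (\<Sum>k\<in>K. \<Sum>l\<in>K. c k * cnj (c l) * (u k \<bullet>c u l))"
      by (intro sum.cong refl) (simp only: ip sum_distrib_left)
    also have "\<dots> = S"
      unfolding S_def using assms(1) by (intro sum.cong refl) (simp add: orth if_distrib cong: if_cong)
    finally show ?thesis .
  qed
  have "complex_of_real (\<Sum>i<n. (cmod (w $ i - f i))\<^sup>2) = (\<Sum>i<n. (w $ i - f i) * cnj (w $ i - f i))"
    unfolding of_real_sum by (simp add: complex_norm_square del: of_real_power)
  also have "\<dots> = (\<Sum>i<n. w $ i * cnj (w $ i)) - S"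
    using wf fw ff by (simp add: algebra_simps sum.distrib sum_subtractf)
  also have "\<dots> = complex_of_real ((vnorm w)\<^sup>2 - (\<Sum>k\<in>K. (cmod (w \<bullet>c u k))\<^sup>2))"
    using assms(2) unfolding vnorm_power2 S_def c_def of_real_diff of_real_sum
    by (simp add: complex_norm_square del: of_real_power)
  finally have "(\<Sum>i<n. (cmod (w $ i - f i))\<^sup>2) = (vnorm w)\<^sup>2 - (\<Sum>k\<in>K. (cmod (w \<bullet>c u k))\<^sup>2)"
    by (simp only: of_real_eq_iff)
  moreover have "0 \<le> (\<Sum>i<n. (cmod (w $ i - f i))\<^sup>2)" by (simp add: sum_nonneg)
  ultimately show ?thesis by simp
qed

section \<open>The spectral theorem for Hermitian matrices\<close>

lemma mat_adjoint_four_block: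
  fixes V :: "complex mat"
  assumes "V \<in> carrier_mat m m"
  shows "mat_adjoint (four_block_mat (1\<^sub>m 1) (0\<^sub>m 1 m) (0\<^sub>m m 1) V) =
    four_block_mat (1\<^sub>m 1) (0\<^sub>m 1 m) (0\<^sub>m m 1) (mat_adjoint V)"
  using assms by (intro eq_matI) auto

text \<open>A root of the characteristic polynomial yields an eigenvector. It is completed to a
  basis and orthogonalised by Gram-Schmidt, which leaves the first vector in place.\<close>

lemma eigenvector_extends_to_unitary:
  fixes A :: "complex mat"
  assumes A: "A \<in> carrier_mat n n" and n: "n \<noteq> 0"
  shows "\<exists>W e. unitary_mat n W \<and> A *\<^sub>v col W 0 = e \<cdot>\<^sub>v col W 0"
proof -
  have "degree (char_poly A) = n" using degree_monic_char_poly[OF A] by simp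
  with n have "\<not> constant (poly (char_poly A))" by (simp add: constant_degree)
  then obtain e where "poly (char_poly A) e = 0" using fundamental_theorem_of_algebra by blast
  hence "eigenvalue A e" using eigenvalue_root_char_poly[OF A] by simp
  then obtain v where "eigenvector A v e" by (auto simp: eigenvalue_def)
  hence v: "v \<in> carrier_vec n" "v \<noteq> 0\<^sub>v n" "A *\<^sub>v v = e \<cdot>\<^sub>v v"
    using A by (auto simp: eigenvector_def)
  interpret cof_vec_space n "TYPE(complex)" .
  define b where "b = basis_completion v"
  define ws where "ws = gram_schmidt n b"
  note bc = basis_completion[OF v(1,2), folded b_def]
  obtain vs where bv: "b = v # vs" using bc(6,7) n by (cases b) auto
  from gram_schmidt_result[OF bc(2,4,5) refl, folded ws_def] bc(6)
  have ws: "set ws \<subseteq> carrier_vec n" "corthogonal ws" "length ws = n" by auto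
  have "hd ws = v" using gram_schmidt_hd[OF v(1), of vs, folded bv] by (simp add: ws_def)
  hence ws0: "ws ! 0 = v" using ws(3) n by (cases ws) auto
  have wsc: "ws ! i \<in> carrier_vec n" if "i < n" for i using ws that by auto
  \<comment> \<open>Gram-Schmidt returns orthogonal nonzero vectors; dividing by their norms makes
    the columns orthonormal.\<close>
  define W where "W = Matrix.mat n n (\<lambda>(i, j). ws ! j $ i / vnorm (ws ! j))"
  have colW: "col W j = (1 / complex_of_real (vnorm (ws ! j))) \<cdot>\<^sub>v ws ! j" if "j < n" for j
    using that wsc[OF that] by (intro eq_vecI) (auto simp: W_def)
  have nz: "vnorm (ws ! j) \<noteq> 0" if "j < n" for j
    using corthogonalD[OF ws(2), of j j] that ws(3) cscalar_prod_self[of "ws ! j"] by auto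
  have "mat_adjoint W * W = 1\<^sub>m n"
  proof (rule eq_matI)
    fix i j assume "i < dim_row (1\<^sub>m n :: complex mat)" "j < dim_col (1\<^sub>m n :: complex mat)"
    hence ij: "i < n" "j < n" by auto
    have "(mat_adjoint W * W) $$ (i, j) =
      (\<Sum>k<n. cnj (ws ! i $ k / vnorm (ws ! i)) * (ws ! j $ k / vnorm (ws ! j)))"
      using ij by (subst index_mult_mat_sum) (auto simp: W_def)
    also have "\<dots> = (ws ! j \<bullet>c ws ! i) / (vnorm (ws ! i) * vnorm (ws ! j))"
      using wsc[OF ij(1)] by (simp add: cscalar_prod_sum sum_divide_distrib mult_ac)
    also have "\<dots> = 1\<^sub>m n $$ (i, j)"
      using ij corthogonalD[OF ws(2), of j i] ws(3) nz[OF ij(1)] cscalar_prod_self[of "ws ! i"]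
      by (auto simp: power2_eq_square)
    finally show "(mat_adjoint W * W) $$ (i, j) = 1\<^sub>m n $$ (i, j)" .
  qed (auto simp: W_def)
  hence "unitary_mat n W" by (intro unitary_matI) (auto simp: W_def)
  moreover have "A *\<^sub>v col W 0 = e \<cdot>\<^sub>v col W 0"
    using n v A by (simp add: colW ws0 mult_mat_vec[of _ n n] smult_smult_assoc mult.commute)
  ultimately show ?thesis by blast
qed

text \<open>Induction on the dimension. Conjugation by a unitary whose first column is an
  eigenvector clears the first column below the diagonal, and by Hermiticity the first row too; the
  induction hypothesis diagonalises the remaining block \<open>B3\<close>.\<close>

theorem hermitian_unitarily_diagonalizable:
  fixes A :: "complex mat"
  assumes "A \<in> carrier_mat n n" "mat_adjoint A = A"
  shows "\<exists>V ev. unitary_mat n V \<and>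
    A = V * mat_diag n (\<lambda>i. complex_of_real (ev i)) * mat_adjoint V"
  using assms
proof (induction n arbitrary: A)
  case 0
  have "A = 1\<^sub>m 0 * mat_diag 0 (\<lambda>i. complex_of_real 0) * mat_adjoint (1\<^sub>m 0)"
    using 0 by (intro eq_matI) auto
  thus ?case using unitary_mat_one[of 0] by (intro exI[of _ "1\<^sub>m 0"] exI[of _ "\<lambda>_. 0"]) auto
next
  case (Suc m)
  let ?n = "Suc m"
  obtain W e where W: "unitary_mat ?n W" and We: "A *\<^sub>v col W 0 = e \<cdot>\<^sub>v col W 0"
    using eigenvector_extends_to_unitary[OF Suc.prems(1)] by blast
  have Wc: "W \<in> carrier_mat ?n ?n" "mat_adjoint W \<in> carrier_mat ?n ?n"
    using W by (auto simp: unitary_mat_def)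
  define B where "B = mat_adjoint W * A * W"
  have Bc: "B \<in> carrier_mat ?n ?n" using Wc Suc.prems by (simp add: B_def)
  have Bh: "mat_adjoint B = B"
  proof -
    have "mat_adjoint B = mat_adjoint W * mat_adjoint (mat_adjoint W * A)"
      unfolding B_def using Wc Suc.prems by (subst mat_adjoint_mult[of _ ?n ?n _ ?n]) auto
    also have "mat_adjoint (mat_adjoint W * A) = A * W"
      using Wc Suc.prems by (subst mat_adjoint_mult[of _ ?n ?n _ ?n]) auto
    finally show ?thesis using Wc Suc.prems by (simp add: B_def assoc_mult_mat[of _ ?n ?n _ ?n _ ?n])
  qed
  have Bh': "B $$ (j, i) = cnj (B $$ (i, j))" if "i < ?n" "j < ?n" for i j
    using that Bc arg_cong[OF Bh, of "\<lambda>M. M $$ (j, i)"] by auto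
  have B0: "B $$ (i, 0) = (if i = 0 then e else 0)" if i: "i < ?n" for i
  proof -
    have "B $$ (i, 0) = (\<Sum>k<?n. cnj (W $$ (k, i)) * (A *\<^sub>v col W 0) $ k)"
      using i Wc Suc.prems unfolding B_def
      by (simp add: assoc_mult_mat[of _ ?n ?n _ ?n _ ?n] index_mult_mat_sum index_mult_mat_vec_sum
          del: index_mult_mat(1) index_mult_mat_vec sum.lessThan_Suc)
    also have "\<dots> = e * (mat_adjoint W * W) $$ (i, 0)"
      unfolding We using i Wc
      by (simp add: index_mult_mat_sum sum_distrib_left mult_ac
          del: index_mult_mat(1) sum.lessThan_Suc)
    finally show ?thesis using W i by (simp add: unitary_mat_def)
  qed
  \<comment> \<open>A diagonal entry of a Hermitian matrix is real, so \<open>e\<close> can be the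
    first value of the real sequence of eigenvalues.\<close>
  have e: "e = complex_of_real (Re e)"
    using Bh'[of 0 0] B0[of 0] by (simp add: complex_eq_iff)
  define B3 where "B3 = Matrix.mat m m (\<lambda>(i, j). B $$ (Suc i, Suc j))"
  have B3c: "B3 \<in> carrier_mat m m" by (simp add: B3_def)
  have "cnj (B $$ (Suc j, Suc i)) = B $$ (Suc i, Suc j)" if "i < m" "j < m" for i j
    using Bh'[of "Suc j" "Suc i"] that by simp
  hence "mat_adjoint B3 = B3" by (intro eq_matI) (auto simp: B3_def)
  then obtain V ev where V: "unitary_mat m V"
    and B3: "B3 = V * mat_diag m (\<lambda>i. complex_of_real (ev i)) * mat_adjoint V"
    using Suc.IH[OF B3c] by blast
  have Vc: "V \<in> carrier_mat m m" "mat_adjoint V \<in> carrier_mat m m" using V by (auto simp: unitary_mat_def)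
  define X where "X = four_block_mat (1\<^sub>m 1) (0\<^sub>m 1 m) (0\<^sub>m m 1) V"
  have Xc: "X \<in> carrier_mat ?n ?n" using Vc unfolding X_def by (intro carrier_matI) auto
  have Xadj: "mat_adjoint X = four_block_mat (1\<^sub>m 1) (0\<^sub>m 1 m) (0\<^sub>m m 1) (mat_adjoint V)"
    unfolding X_def using Vc by (intro mat_adjoint_four_block)
  have Xac: "mat_adjoint X \<in> carrier_mat ?n ?n" using Xc by simp
  have "mat_adjoint X * X = four_block_mat (1\<^sub>m 1) (0\<^sub>m 1 m) (0\<^sub>m m 1) (1\<^sub>m m)"
    unfolding Xadj unfolding X_def using Vc V
    by (subst mult_four_block_mat[of _ 1 1 _ m _ m]) (auto simp: unitary_mat_def)
  also have "\<dots> = 1\<^sub>m ?n" by (intro eq_matI) auto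
  finally have X: "unitary_mat ?n X" using Xc by (intro unitary_matI)
  define D where "D = mat_diag ?n (\<lambda>i. complex_of_real (case_nat (Re e) ev i))"
  have Dc: "D \<in> carrier_mat ?n ?n" by (simp add: D_def)
  have D: "D = four_block_mat (mat_diag 1 (\<lambda>_. e)) (0\<^sub>m 1 m) (0\<^sub>m m 1)
      (mat_diag m (\<lambda>i. complex_of_real (ev i)))"
    using e by (intro eq_matI) (auto simp: D_def mat_diag_def split: nat.splits)
  have four_block: "four_block_mat (1\<^sub>m 1) (0\<^sub>m 1 m) (0\<^sub>m m 1) V * four_block_mat E (0\<^sub>m 1 m) (0\<^sub>m m 1) F *
      four_block_mat (1\<^sub>m 1) (0\<^sub>m 1 m) (0\<^sub>m m 1) (mat_adjoint V) =
      four_block_mat E (0\<^sub>m 1 m) (0\<^sub>m m 1) (V * F * mat_adjoint V)"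
    if EF: "E \<in> carrier_mat 1 1" "F \<in> carrier_mat m m" for E F
  proof -
    have VF: "V * F \<in> carrier_mat m m" "V * F * mat_adjoint V \<in> carrier_mat m m" using Vc EF by simp_all
    have "four_block_mat (1\<^sub>m 1) (0\<^sub>m 1 m) (0\<^sub>m m 1) V * four_block_mat E (0\<^sub>m 1 m) (0\<^sub>m m 1) F =
        four_block_mat E (0\<^sub>m 1 m) (0\<^sub>m m 1) (V * F)"
      using Vc EF VF by (subst mult_four_block_mat[of _ 1 1 _ m _ m]) auto
    moreover have "four_block_mat E (0\<^sub>m 1 m) (0\<^sub>m m 1) (V * F) *
        four_block_mat (1\<^sub>m 1) (0\<^sub>m 1 m) (0\<^sub>m m 1) (mat_adjoint V) =
        four_block_mat E (0\<^sub>m 1 m) (0\<^sub>m m 1) (V * F * mat_adjoint V)"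
      using Vc EF VF by (subst mult_four_block_mat[of _ 1 1 _ m _ m]) auto
    ultimately show ?thesis by simp
  qed
  have "X * D * mat_adjoint X = four_block_mat (mat_diag 1 (\<lambda>_. e)) (0\<^sub>m 1 m) (0\<^sub>m m 1) B3"
    unfolding Xadj D B3 unfolding X_def by (rule four_block) simp_all
  also have "\<dots> = B"
  proof (rule eq_matI)
    fix i j assume "i < dim_row B" "j < dim_col B"
    hence ij: "i < ?n" "j < ?n" using Bc by auto
    thus "four_block_mat (mat_diag 1 (\<lambda>_. e)) (0\<^sub>m 1 m) (0\<^sub>m m 1) B3 $$ (i, j) = B $$ (i, j)"
      using B0[of i] B0[of j] Bh'[of j i]
      by (cases i; cases j) (auto simp: B3_def mat_diag_def)
  qed (use Bc in \<open>auto simp: B3_def mat_diag_def\<close>)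
  finally have BX: "B = X * D * mat_adjoint X" ..
  have "W * X * D * mat_adjoint (W * X) = W * B * mat_adjoint W"
    unfolding BX using Wc Xc Xac Dc
    by (simp add: mat_adjoint_mult[of W ?n ?n X ?n] assoc_mult_mat[of _ ?n ?n _ ?n _ ?n])
  also have "\<dots> = (W * mat_adjoint W) * A * (W * mat_adjoint W)"
    unfolding B_def using Wc Suc.prems by (simp add: assoc_mult_mat[of _ ?n ?n _ ?n _ ?n])
  also have "\<dots> = A" using W Suc.prems by (simp add: unitary_mat_def)
  finally have "A = (W * X) * D * mat_adjoint (W * X)" ..
  thus ?case unfolding D_def using unitary_mat_mult[OF W X] by blast
qed

section \<open>Renyi entropy and product vectors\<close>

lemma mat_trace_diagonalized:
  assumes "unitary_mat n V"
  shows "mat_trace (V * mat_diag n f * mat_adjoint V) = (\<Sum>k<n. f k)"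
proof -
  have c: "V \<in> carrier_mat n n" using assms by (simp add: unitary_mat_def)
  have "mat_trace (V * mat_diag n f * mat_adjoint V) =
      (\<Sum>i<n. \<Sum>k<n. f k * (cnj (V $$ (i, k)) * V $$ (i, k)))"
    using c unfolding mat_trace_def mat_diag_mult_right[OF c]
    by (auto simp: index_mult_mat_sum mult_ac simp del: index_mult_mat(1) intro!: sum.cong)
  also have "\<dots> = (\<Sum>k<n. \<Sum>i<n. f k * (cnj (V $$ (i, k)) * V $$ (i, k)))"
    by (rule sum.swap)
  also have "\<dots> = (\<Sum>k<n. f k * (mat_adjoint V * V) $$ (k, k))"
    using c by (auto simp: index_mult_mat_sum sum_distrib_left simp del: index_mult_mat(1) intro!: sum.cong)
  also have "\<dots> = (\<Sum>k<n. f k)" using assms by (simp add: unitary_mat_def)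
  finally show ?thesis .
qed

text \<open>Moving \<open>V\<close> across the inner product leaves a diagonal matrix acting on the
  coordinates of \<open>u\<close> in the eigenbasis. For unit \<open>u\<close> the right side is a
  convex combination of the eigenvalues.\<close>

lemma expect_diagonalized:
  assumes V: "unitary_mat n V" and u: "u \<in> carrier_vec n"
  shows "expect (V * mat_diag n (\<lambda>i. complex_of_real (ev i)) * mat_adjoint V) u =
    (\<Sum>k<n. ev k * (cmod ((mat_adjoint V *\<^sub>v u) $ k))\<^sup>2)"
proof -
  define w where "w = mat_adjoint V *\<^sub>v u"
  let ?D = "mat_diag n (\<lambda>i. complex_of_real (ev i))"
  have c: "V \<in> carrier_mat n n" "mat_adjoint V \<in> carrier_mat n n" "?D \<in> carrier_mat n n"
    using V by (auto simp: unitary_mat_def)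
  have w: "w \<in> carrier_vec n" using c u by (simp add: w_def)
  have "V * ?D * mat_adjoint V *\<^sub>v u = V *\<^sub>v (?D *\<^sub>v w)"
    unfolding w_def using c u by (simp add: assoc_mult_mat_vec[of _ n n _ n])
  moreover have "(V *\<^sub>v (?D *\<^sub>v w)) \<bullet>c u = (?D *\<^sub>v w) \<bullet>c (mat_adjoint V *\<^sub>v u)"
    by (rule mult_mat_vec_cscalar[of V n n]) (use c u w in simp_all)
  ultimately have "(V * ?D * mat_adjoint V *\<^sub>v u) \<bullet>c u = (?D *\<^sub>v w) \<bullet>c w"
    by (simp only: w_def)
  also have "\<dots> = (\<Sum>k<n. complex_of_real (ev k) * (w $ k * cnj (w $ k)))"
    using w by (simp add: cscalar_prod_sum mat_diag_mult_vec mult.assoc)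
  also have "\<dots> = complex_of_real (\<Sum>k<n. ev k * (cmod (w $ k))\<^sup>2)"
    unfolding of_real_sum of_real_mult by (simp add: complex_norm_square del: of_real_power)
  finally show ?thesis by (simp add: expect_def w_def)
qed

text \<open>The hypotheses make the \<open>SOME\<close> in \<^const>\<open>mat_powr\<close> range over a nonempty set.\<close>

lemma mat_trace_mat_powr:
  assumes A: "A \<in> carrier_mat n n" "mat_adjoint A = A"
    and psd: "\<And>u. u \<in> carrier_vec n \<Longrightarrow> 0 \<le> expect A u"
  obtains V ev where "unitary_mat n V" "\<And>i. i < n \<Longrightarrow> 0 \<le> ev i"
    "A = V * mat_diag n (\<lambda>i. complex_of_real (ev i)) * mat_adjoint V"
    "mat_trace (mat_powr A s) = complex_of_real (\<Sum>i<n. ev i powr s)"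
proof -
  define Q where "Q R V ev \<longleftrightarrow> unitary_mat n V \<and> (\<forall>i<n. 0 \<le> ev i) \<and>
       A = V * mat_diag n (\<lambda>i. complex_of_real (ev i)) * mat_adjoint V \<and>
       R = V * mat_diag n (\<lambda>i. complex_of_real (ev i powr s)) * mat_adjoint V" for R V ev
  obtain V ev where V: "unitary_mat n V"
    and AV: "A = V * mat_diag n (\<lambda>i. complex_of_real (ev i)) * mat_adjoint V"
    using hermitian_unitarily_diagonalizable[OF A] by blast
  have Vc: "V \<in> carrier_mat n n" using V by (rule unitary_mat_carrier)
  \<comment> \<open>Positivity is tested on the \<open>i\<close>-th eigenvector, whose expectation
    is \<open>ev i\<close>.\<close>
  have "0 \<le> ev i" if i: "i < n" for i
  proof -
    have u: "V *\<^sub>v unit_vec n i \<in> carrier_vec n" using Vc by simp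
    have "mat_adjoint V *\<^sub>v (V *\<^sub>v unit_vec n i) = unit_vec n i"
      using Vc V by (simp add: assoc_mult_mat_vec[symmetric, of _ n n _ n] unitary_mat_def)
    hence "expect A (V *\<^sub>v unit_vec n i) = (\<Sum>k<n. ev k * (cmod (unit_vec n i $ k))\<^sup>2)"
      using expect_diagonalized[OF V u, of ev] unfolding AV[symmetric] by simp
    also have "\<dots> = (\<Sum>k<n. if k = i then ev k else 0)"
      using i by (intro sum.cong) auto
    also have "\<dots> = ev i" using i by simp
    finally show ?thesis using psd[OF u] by simp
  qed
  hence "Q (V * mat_diag n (\<lambda>i. complex_of_real (ev i powr s)) * mat_adjoint V) V ev"
    using V AV by (simp add: Q_def)
  hence "\<exists>R V ev. Q R V ev" by blast
  \<comment> \<open>The decomposition behind the chosen matrix may differ from \<open>V\<close>,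
    \<open>ev\<close>; the lemma therefore returns the chosen one.\<close>
  from someI_ex[OF this] have "\<exists>V ev. Q (SOME R. \<exists>V ev. Q R V ev) V ev" .
  moreover have "mat_powr A s = (SOME R. \<exists>V ev. Q R V ev)"
    using A(1) by (simp add: mat_powr_def Q_def Let_def)
  ultimately have "\<exists>V ev. Q (mat_powr A s) V ev" by simp
  then obtain V' ev' where Q: "Q (mat_powr A s) V' ev'" by blast
  hence "mat_trace (mat_powr A s) = (\<Sum>i<n. complex_of_real (ev' i powr s))"
    using mat_trace_diagonalized[of n V'] by (auto simp: Q_def)
  with Q show ?thesis by (intro that[of V' ev']) (auto simp: Q_def)
qed

text \<open>Some eigenvalue is at least the expectation in a unit vector, hence at least
  \<open>q\<close>. Dropping all other eigenvalues bounds the trace of the power from below by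
  \<open>q powr \<alpha>\<close>.\<close>

lemma renyi_le_of_expect:
  assumes A: "A \<in> carrier_mat n n" "mat_adjoint A = A"
    and psd: "\<And>u. u \<in> carrier_vec n \<Longrightarrow> 0 \<le> expect A u"
    and u: "u \<in> carrier_vec n" "vnorm u = 1" and q: "0 < q" "q \<le> expect A u"
    and b: "1 < b" and \<alpha>: "1 < \<alpha>"
  shows "renyi b \<alpha> A \<le> \<alpha> / (\<alpha> - 1) * log b (1 / q)"
proof -
  obtain V ev where V: "unitary_mat n V" and ev: "\<And>i. i < n \<Longrightarrow> 0 \<le> ev i"
    and AV: "A = V * mat_diag n (\<lambda>i. complex_of_real (ev i)) * mat_adjoint V"
    and tr: "mat_trace (mat_powr A \<alpha>) = complex_of_real (\<Sum>i<n. ev i powr \<alpha>)"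
    using mat_trace_mat_powr[OF A psd] by blast
  define w where "w = mat_adjoint V *\<^sub>v u"
  have "w \<in> carrier_vec n" using u V by (simp add: w_def unitary_mat_def)
  moreover have "vnorm w = 1"
    using unitary_vnorm[OF unitary_mat_adjoint[OF V] u(1)] u(2) by (simp add: w_def)
  ultimately have w: "(\<Sum>k<n. (cmod (w $ k))\<^sup>2) = 1"
    using vnorm_power2[of w] by simp
  \<comment> \<open>If all eigenvalues were below \<open>q\<close>, so would be their weighted
    average; strictness comes from a nonzero coordinate of \<open>w\<close>.\<close>
  have "\<exists>k<n. q \<le> ev k"
  proof (rule ccontr)
    assume "\<not> ?thesis"
    hence less: "ev k < q" if "k < n" for k using that by auto
    obtain k where k: "k < n" "w $ k \<noteq> 0"
      using w by (metis (no_types, lifting) lessThan_iff norm_zero power_zero_numeral sum.neutral zero_neq_one)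
    have "(\<Sum>k<n. ev k * (cmod (w $ k))\<^sup>2) < (\<Sum>k<n. q * (cmod (w $ k))\<^sup>2)"
    proof (rule sum_strict_mono_ex1)
      show "\<forall>k\<in>{..<n}. ev k * (cmod (w $ k))\<^sup>2 \<le> q * (cmod (w $ k))\<^sup>2"
        using less by (auto intro!: mult_right_mono simp: less_imp_le)
      show "\<exists>k\<in>{..<n}. ev k * (cmod (w $ k))\<^sup>2 < q * (cmod (w $ k))\<^sup>2"
        using k less[OF k(1)] by (intro bexI[of _ k] mult_strict_right_mono) auto
    qed simp
    also have "\<dots> = q" using w by (simp add: sum_distrib_left[symmetric])
    also have "q \<le> expect A u" by (rule q)
    also have "\<dots> = (\<Sum>k<n. ev k * (cmod (w $ k))\<^sup>2)"
      using expect_diagonalized[OF V u(1), of ev] by (simp add: AV[symmetric] w_def)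
    finally show False by simp
  qed
  then obtain k where k: "k < n" "q \<le> ev k" by blast
  have "q powr \<alpha> \<le> ev k powr \<alpha>" using q k \<alpha> by (intro powr_mono2) auto
  also have "\<dots> \<le> (\<Sum>i<n. ev i powr \<alpha>)"
    using k by (intro member_le_sum) auto
  finally have "log b (q powr \<alpha>) \<le> log b (\<Sum>i<n. ev i powr \<alpha>)"
    using q b by (intro log_mono) auto
  hence "\<alpha> * log b q \<le> log b (\<Sum>i<n. ev i powr \<alpha>)" using q by (simp add: log_powr)
  \<comment> \<open>For \<open>\<alpha> > 1\<close> the prefactor of the entropy is negative, so the
    lower bound on the trace becomes an upper bound on the entropy.\<close>
  hence "(1 / (\<alpha> - 1)) * - log b (\<Sum>i<n. ev i powr \<alpha>) \<le> (1 / (\<alpha> - 1)) * - (\<alpha> * log b q)"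
    using \<alpha> by (intro mult_left_mono) auto
  moreover have "renyi b \<alpha> A = (1 / (\<alpha> - 1)) * - log b (\<Sum>i<n. ev i powr \<alpha>)"
    unfolding renyi_def tr using minus_divide_right[of "log b (\<Sum>i<n. ev i powr \<alpha>)" "\<alpha> - 1"] by simp
  moreover have "(1 / (\<alpha> - 1)) * - (\<alpha> * log b q) = \<alpha> / (\<alpha> - 1) * log b (1 / q)"
    using q b by (simp add: log_divide)
  ultimately show ?thesis by simp
qed

text \<open>Read the evolved vector as a square matrix with row index in A and column index in B:
  the reduced density matrix is this matrix times its adjoint.\<close>

lemma index_rho_A:
  fixes U \<psi>
  defines "\<Psi> \<equiv> U *\<^sub>v \<psi>"
  assumes N: "even N" and U: "U \<in> carrier_mat (d ^ N) (d ^ N)" and \<psi>: "\<psi> \<in> carrier_vec (d ^ N)"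
    and xy: "x < d ^ (N div 2)" "y < d ^ (N div 2)"
  shows "trace_B d N (U * ket_bra \<psi> * mat_adjoint U) $$ (x, y) =
    (\<Sum>z<d ^ (N div 2). \<Psi> $ (x * d ^ (N div 2) + z) * cnj (\<Psi> $ (y * d ^ (N div 2) + z)))"
proof -
  let ?D = "d ^ (N div 2)"
  have DD: "?D * ?D = d ^ N"
    using N by (metis even_two_times_div_two mult_2 power_add)
  have bound: "x * ?D + z < d ^ N" if "x < ?D" "z < ?D" for x z
    unfolding DD[symmetric] using that
    using mult_add_less by blast
  have K: "ket_bra \<psi> \<in> carrier_mat (d ^ N) (d ^ N)" using \<psi> by (simp add: ket_bra_def)
  have "(U * ket_bra \<psi> * mat_adjoint U) $$ (i, j) = \<Psi> $ i * cnj (\<Psi> $ j)"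
    if "i < d ^ N" "j < d ^ N" for i j
  proof -
    have "(U * ket_bra \<psi> * mat_adjoint U) $$ (i, j) =
        (\<Sum>k<d ^ N. (\<Sum>l<d ^ N. U $$ (i, l) * (\<psi> $ l * cnj (\<psi> $ k))) * cnj (U $$ (j, k)))"
      using that U K \<psi> by (auto simp: index_mult_mat_sum ket_bra_def simp del: index_mult_mat(1) intro!: sum.cong)
    also have "\<dots> = (\<Sum>k<d ^ N. \<Psi> $ i * cnj (\<psi> $ k) * cnj (U $$ (j, k)))"
      using that U \<psi> unfolding \<Psi>_def
      by (intro sum.cong refl) (auto simp: index_mult_mat_vec_sum sum_distrib_right mult.assoc simp del: index_mult_mat_vec)
    also have "\<dots> = \<Psi> $ i * cnj (\<Psi> $ j)"
      using that U \<psi> unfolding \<Psi>_def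
      by (auto simp: index_mult_mat_vec_sum sum_distrib_left mult_ac simp del: index_mult_mat_vec intro!: sum.cong)
    finally show ?thesis .
  qed
  thus ?thesis using xy bound by (auto simp: trace_B_def Let_def intro!: sum.cong)
qed

text \<open>The expectation of the reduced state in \<open>u\<close> is the squared norm of the
  vector on B obtained by contracting \<open>\<Psi>\<close> with \<open>u\<close>. This gives
  positivity as well, so \<open>renyi_le_of_expect\<close> applies.\<close>

lemma renyi_rho_A_le:
  fixes U \<psi>
  defines "\<Psi> \<equiv> U *\<^sub>v \<psi>"
  assumes N: "even N" and U: "U \<in> carrier_mat (d ^ N) (d ^ N)" and \<psi>: "\<psi> \<in> carrier_vec (d ^ N)"
    and u: "u \<in> carrier_vec (d ^ (N div 2))" "vnorm u = 1"
    and q: "0 < q"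
      "q \<le> (\<Sum>z<d ^ (N div 2). (cmod (\<Sum>x<d ^ (N div 2). \<Psi> $ (x * d ^ (N div 2) + z) * cnj (u $ x)))\<^sup>2)"
    and b: "1 < b" and \<alpha>: "1 < \<alpha>"
  shows "renyi b \<alpha> (trace_B d N (U * ket_bra \<psi> * mat_adjoint U)) \<le> \<alpha> / (\<alpha> - 1) * log b (1 / q)"
proof -
  let ?D = "d ^ (N div 2)" and ?\<rho> = "trace_B d N (U * ket_bra \<psi> * mat_adjoint U)"
  have c: "?\<rho> \<in> carrier_mat ?D ?D" by (simp add: trace_B_def Let_def)
  note ix = index_rho_A[OF N U \<psi>, folded \<Psi>_def]
  have h: "mat_adjoint ?\<rho> = ?\<rho>"
    using c by (intro eq_matI) (auto simp: ix mult.commute)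
  have ex: "expect ?\<rho> u = (\<Sum>z<?D. (cmod (\<Sum>x<?D. \<Psi> $ (x * ?D + z) * cnj (u $ x)))\<^sup>2)"
    if u: "u \<in> carrier_vec ?D" for u
  proof -
    have "(?\<rho> *\<^sub>v u) \<bullet>c u = (\<Sum>x<?D. \<Sum>y<?D. \<Sum>z<?D.
        \<Psi> $ (x * ?D + z) * cnj (u $ x) * cnj (\<Psi> $ (y * ?D + z) * cnj (u $ y)))"
      using c u
      by (auto simp: cscalar_prod_sum index_mult_mat_vec_sum ix sum_distrib_right sum_distrib_left mult_ac
          simp del: index_mult_mat_vec intro!: sum.cong)
    also have "\<dots> = (\<Sum>x<?D. \<Sum>z<?D. \<Sum>y<?D.
        \<Psi> $ (x * ?D + z) * cnj (u $ x) * cnj (\<Psi> $ (y * ?D + z) * cnj (u $ y)))"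
      by (intro sum.cong refl sum.swap)
    also have "\<dots> = (\<Sum>z<?D. \<Sum>x<?D. \<Sum>y<?D.
        \<Psi> $ (x * ?D + z) * cnj (u $ x) * cnj (\<Psi> $ (y * ?D + z) * cnj (u $ y)))"
      by (rule sum.swap)
    also have "\<dots> = (\<Sum>z<?D. (\<Sum>x<?D. \<Psi> $ (x * ?D + z) * cnj (u $ x)) *
        cnj (\<Sum>x<?D. \<Psi> $ (x * ?D + z) * cnj (u $ x)))"
      unfolding cnj_sum sum_product ..
    also have "\<dots> = complex_of_real (\<Sum>z<?D. (cmod (\<Sum>x<?D. \<Psi> $ (x * ?D + z) * cnj (u $ x)))\<^sup>2)"
      unfolding of_real_sum complex_norm_square ..
    finally show ?thesis by (simp add: expect_def)
  qed
  show ?thesis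
    by (rule renyi_le_of_expect[OF c h _ u q(1) _ b \<alpha>])
       (use ex u q in \<open>auto simp: sum_nonneg\<close>)
qed

section \<open>Bond operators and digits\<close>

lemma less_mult_obtain:
  assumes "x < m * (n::nat)"
  obtains u w where "u < m" "w < n" "x = u * n + w"
proof (rule that)
  show "x div n < m" using assms by (simp add: less_mult_imp_div_less)
  show "x mod n < n" using assms by (cases "n = 0") auto
qed simp

lemma mult_add_eq_iff:
  fixes u u' w w' n :: nat
  shows "w < n \<Longrightarrow> w' < n \<Longrightarrow> u * n + w = u' * n + w' \<longleftrightarrow> u = u' \<and> w = w'"
  by (metis add_diff_cancel_left' div_mult_self3 div_less add_0_right mult_is_0 not_less_zero add.commute)

lemma digit_less: "0 < d \<Longrightarrow> digit d N x i < d"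
  by (simp add: digit_def)

text \<open>Site 1 is the most significant digit, so the first \<open>m\<close> sites of a chain of
  length \<open>m + n\<close> read the high part \<open>u\<close>. The counterpart
  \<open>digit_lower\<close> treats the last \<open>n\<close> sites and \<open>w\<close>.\<close>

lemma digit_upper:
  assumes "w < d ^ n" "i \<le> m"
  shows "digit d (m + n) (u * d ^ n + w) i = digit d m u i"
proof -
  have "d ^ (m + n - i) = d ^ n * d ^ (m - i)"
    using assms by (simp add: power_add[symmetric] add.commute)
  moreover have "(u * d ^ n + w) div d ^ n = u"
  proof -
    have "d ^ n \<noteq> 0" using assms(1) by linarith
    thus ?thesis using assms(1) by (subst div_mult_self3) auto
  qed
  ultimately show ?thesis by (simp add: digit_def div_mult2_eq)
qed

lemma digit_lower:
  assumes "w < d ^ n" "1 \<le> j" "j \<le> n"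
  shows "digit d (m + n) (u * d ^ n + w) (m + j) = digit d n w j"
proof -
  have d: "0 < d" using assms by (cases "d = 0") (auto simp: power_0_left)
  have "d ^ n = d ^ (j - 1) * d * d ^ (n - j)"
    using assms by (simp add: power_add[symmetric] power_Suc2[symmetric] del: power_Suc)
  hence "(u * d ^ n + w) div d ^ (n - j) = (u * d ^ (j - 1) * d * d ^ (n - j) + w) div d ^ (n - j)"
    by (simp add: mult.assoc)
  also have "\<dots> = u * d ^ (j - 1) * d + w div d ^ (n - j)"
    using d by (subst div_mult_self3) auto
  finally show ?thesis by (simp add: digit_def)
qed

text \<open>Induction on the length, splitting off the last site, whose digit is the remainder
  modulo \<open>d\<close>.\<close>

lemma digit_eqI:
  assumes "x < d ^ N" "y < d ^ N" "\<And>i. 1 \<le> i \<Longrightarrow> i \<le> N \<Longrightarrow> digit d N x i = digit d N y i"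
  shows "x = y"
  using assms
proof (induction N arbitrary: x y)
  case (Suc N)
  have "x < d ^ N * d" "y < d ^ N * d" using Suc.prems(1,2) by (auto simp: mult.commute)
  then obtain u w u' w' where *: "u < d ^ N" "w < d" "x = u * d + w" "u' < d ^ N" "w' < d" "y = u' * d + w'"
    by (elim less_mult_obtain)
  have "digit d N u i = digit d N u' i" if "1 \<le> i" "i \<le> N" for i
    using Suc.prems(3)[of i] digit_upper[of w d 1 i N u] digit_upper[of w' d 1 i N u'] * that by simp
  moreover have "w = w'"
    using Suc.prems(3)[of "Suc N"] digit_lower[of w d 1 1 N u] digit_lower[of w' d 1 1 N u'] *
    by (simp add: digit_def)
  ultimately show ?case using Suc.IH[of u u'] * by simp
qed simp

text \<open>Distributivity over all configurations, again by splitting off the last site. It makes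
  inner products of product states factor over the sites.\<close>

lemma sum_prod_digit:
  fixes f :: "nat \<Rightarrow> nat \<Rightarrow> 'a::comm_semiring_1"
  shows "(\<Sum>x<d ^ N. \<Prod>i\<in>{1..N}. f i (digit d N x i)) = (\<Prod>i\<in>{1..N}. \<Sum>k<d. f i k)"
proof (induction N)
  case (Suc N)
  have "(\<Sum>x<d ^ Suc N. \<Prod>i\<in>{1..Suc N}. f i (digit d (Suc N) x i)) =
      (\<Sum>u<d ^ N. \<Sum>w<d. (\<Prod>i\<in>{1..N}. f i (digit d (Suc N) (u * d + w) i)) *
        f (Suc N) (digit d (Suc N) (u * d + w) (Suc N)))"
    by (simp add: sum_lessThan_mult mult.commute[of d])
  also have "\<dots> = (\<Sum>u<d ^ N. \<Sum>w<d. (\<Prod>i\<in>{1..N}. f i (digit d N u i)) * f (Suc N) w)"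
  proof (intro sum.cong refl arg_cong2[of _ _ _ _ "(*)"] prod.cong)
    fix u w i assume "w \<in> {..<d}" "i \<in> {1..N}"
    thus "f i (digit d (Suc N) (u * d + w) i) = f i (digit d N u i)"
      using digit_upper[of w d 1 i N u] by simp
  next
    fix u w assume "w \<in> {..<d}"
    thus "f (Suc N) (digit d (Suc N) (u * d + w) (Suc N)) = f (Suc N) w"
      using digit_lower[of w d 1 1 N u] by (simp add: digit_def)
  qed
  also have "\<dots> = (\<Prod>i\<in>{1..Suc N}. \<Sum>k<d. f i k)"
    unfolding sum_product[symmetric] Suc.IH by simp
  finally show ?case .
qed simp

section \<open>Matrix entries of bond operators\<close>

lemma bond_op_carrier [simp]: "bond_op d N j A \<in> carrier_mat (d ^ N) (d ^ N)"
  by (simp add: bond_op_def)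

lemma dim_bond_op [simp]: "dim_row (bond_op d N j A) = d ^ N" "dim_col (bond_op d N j A) = d ^ N"
  by (simp_all add: bond_op_def)

lemma index_bond_op:
  "x < d ^ N \<Longrightarrow> y < d ^ N \<Longrightarrow> bond_op d N j A $$ (x, y) =
    (if \<forall>i\<in>{1..N} - {j, j + 1}. digit d N x i = digit d N y i
     then A $$ (digit d N x j * d + digit d N x (j + 1), digit d N y j * d + digit d N y (j + 1))
     else 0)"
  by (simp add: bond_op_def)

text \<open>The gate acts as its version on \<open>m\<close> sites tensored with the identity: the
  last \<open>n\<close> digits lie off the bond and have to agree, which means
  \<open>w = w'\<close>.\<close>

lemma index_bond_op_left:
  assumes "u < d ^ m" "w < d ^ n" "u' < d ^ m" "w' < d ^ n" "j + 1 \<le> m"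
  shows "bond_op d (m + n) j A $$ (u * d ^ n + w, u' * d ^ n + w') =
    (if w = w' then bond_op d m j A $$ (u, u') else 0)"
proof -
  let ?x = "u * d ^ n + w" and ?y = "u' * d ^ n + w'"
  have lt: "?x < d ^ (m + n)" "?y < d ^ (m + n)"
    unfolding power_add using assms by (auto intro: mult_add_less)
  have up: "digit d (m + n) ?x i = digit d m u i" "digit d (m + n) ?y i = digit d m u' i" if "i \<le> m" for i
    using assms that by (auto intro: digit_upper)
  have lo: "digit d (m + n) ?x (m + i) = digit d n w i" "digit d (m + n) ?y (m + i) = digit d n w' i"
    if "1 \<le> i" "i \<le> n" for i
    using assms that by (auto intro: digit_lower)
  have c: "(\<forall>i\<in>{1..m + n} - {j, j + 1}. digit d (m + n) ?x i = digit d (m + n) ?y i) \<longleftrightarrow>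
      w = w' \<and> (\<forall>i\<in>{1..m} - {j, j + 1}. digit d m u i = digit d m u' i)" (is "?l \<longleftrightarrow> ?r")
  proof
    assume l: ?l
    have "digit d n w i = digit d n w' i" if "1 \<le> i" "i \<le> n" for i
      using l lo[OF that] assms(5) that by (auto dest!: bspec[of _ _ "m + i"])
    hence "w = w'" using assms by (intro digit_eqI[of w d n w']) auto
    moreover have "digit d m u i = digit d m u' i" if "i \<in> {1..m} - {j, j + 1}" for i
      using l up[of i] that by auto
    ultimately show ?r by blast
  next
    assume r: ?r
    show ?l
    proof
      fix i assume i: "i \<in> {1..m + n} - {j, j + 1}"
      show "digit d (m + n) ?x i = digit d (m + n) ?y i"
      proof (cases "i \<le> m")
        case True thus ?thesis using r up[of i] i by auto
      next
        case False thus ?thesis using r lo[of "i - m"] i by auto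
      qed
    qed
  qed
  have jm: "j \<le> m" "j + 1 \<le> m" using assms by auto
  show ?thesis
    unfolding index_bond_op[OF lt] c index_bond_op[OF assms(1,3)] up[OF jm(1)] up[OF jm(2)] by auto
qed

text \<open>Mirror image of \<open>index_bond_op_left\<close>: bonds of the right part are numbered
  from its own first site, hence the shift \<open>m + j\<close>, and \<open>1 \<le> j\<close> keeps
  the bond off site \<open>m\<close>.\<close>

lemma index_bond_op_right:
  assumes "u < d ^ m" "w < d ^ n" "u' < d ^ m" "w' < d ^ n" "1 \<le> j" "j + 1 \<le> n"
  shows "bond_op d (m + n) (m + j) A $$ (u * d ^ n + w, u' * d ^ n + w') =
    (if u = u' then bond_op d n j A $$ (w, w') else 0)"
proof -
  let ?x = "u * d ^ n + w" and ?y = "u' * d ^ n + w'"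
  have lt: "?x < d ^ (m + n)" "?y < d ^ (m + n)"
    unfolding power_add using assms by (auto intro: mult_add_less)
  have up: "digit d (m + n) ?x i = digit d m u i" "digit d (m + n) ?y i = digit d m u' i" if "i \<le> m" for i
    using assms that by (auto intro: digit_upper)
  have lo: "digit d (m + n) ?x (m + i) = digit d n w i" "digit d (m + n) ?y (m + i) = digit d n w' i"
    if "1 \<le> i" "i \<le> n" for i
    using assms that by (auto intro: digit_lower)
  have c: "(\<forall>i\<in>{1..m + n} - {m + j, m + j + 1}. digit d (m + n) ?x i = digit d (m + n) ?y i) \<longleftrightarrow>
      u = u' \<and> (\<forall>i\<in>{1..n} - {j, j + 1}. digit d n w i = digit d n w' i)" (is "?l \<longleftrightarrow> ?r")
  proof
    assume l: ?l
    have "digit d m u i = digit d m u' i" if "1 \<le> i" "i \<le> m" for i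
      using l up[OF that(2)] assms(5) that by (auto dest!: bspec[of _ _ i])
    hence "u = u'" using assms by (intro digit_eqI[of u d m u']) auto
    moreover have "digit d n w i = digit d n w' i" if "i \<in> {1..n} - {j, j + 1}" for i
      using l lo[of i] that by (auto dest!: bspec[of _ _ "m + i"])
    ultimately show ?r by blast
  next
    assume r: ?r
    show ?l
    proof
      fix i assume i: "i \<in> {1..m + n} - {m + j, m + j + 1}"
      show "digit d (m + n) ?x i = digit d (m + n) ?y i"
      proof (cases "i \<le> m")
        case True thus ?thesis using r up[of i] i by auto
      next
        case False
        hence "i - m \<in> {1..n} - {j, j + 1}" using i by auto
        thus ?thesis using r lo[of "i - m"] False by auto
      qed
    qed
  qed
  have jn: "1 \<le> j" "j \<le> n" "1 \<le> j + 1" "j + 1 \<le> n" using assms by auto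
  show ?thesis
    unfolding index_bond_op[OF lt] c index_bond_op[OF assms(2,4)] lo[OF jn(1,2)]
    unfolding add.assoc lo[OF jn(3,4)] by auto
qed

section \<open>Unitarity of embedded gates\<close>

lemma unitary_mat_iff_columns:
  assumes "B \<in> carrier_mat n n"
  shows "unitary_mat n B \<longleftrightarrow>
    (\<forall>x<n. \<forall>y<n. (\<Sum>k<n. cnj (B $$ (k, x)) * B $$ (k, y)) = (if x = y then 1 else 0))"
proof -
  have e: "(mat_adjoint B * B) $$ (x, y) = (\<Sum>k<n. cnj (B $$ (k, x)) * B $$ (k, y))"
    if "x < n" "y < n" for x y
    using that assms by (simp add: index_mult_mat_sum del: index_mult_mat(1))
  have "mat_adjoint B * B = 1\<^sub>m n \<longleftrightarrow>
      (\<forall>x<n. \<forall>y<n. (mat_adjoint B * B) $$ (x, y) = (if x = y then 1 else 0))"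
    using assms by (auto simp del: index_mult_mat(1) intro!: eq_matI)
  moreover have "unitary_mat n B \<longleftrightarrow> mat_adjoint B * B = 1\<^sub>m n"
    using unitary_matI[OF assms] by (auto simp: unitary_mat_def)
  ultimately show ?thesis by (simp add: e)
qed

text \<open>The entries say that \<open>B\<close> is \<open>K\<close> tensored with the identity, so
  the inner product of two columns is that of two columns of \<open>K\<close> times that of two
  standard basis vectors.\<close>

lemma unitary_mat_tensor_left:
  assumes B: "B \<in> carrier_mat (m * n) (m * n)" and K: "unitary_mat m K"
    and ix: "\<And>u u' w w'. u < m \<Longrightarrow> u' < m \<Longrightarrow> w < n \<Longrightarrow> w' < n \<Longrightarrow>
      B $$ (u * n + w, u' * n + w') = (if w = w' then K $$ (u, u') else 0)"
  shows "unitary_mat (m * n) B"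
  unfolding unitary_mat_iff_columns[OF B]
proof (intro allI impI)
  fix x y assume "x < m * n" "y < m * n"
  then obtain u w u' w' where *: "u < m" "w < n" "x = u * n + w" "u' < m" "w' < n" "y = u' * n + w'"
    by (elim less_mult_obtain)
  have Kc: "K \<in> carrier_mat m m" using K by (rule unitary_mat_carrier)
  have "(\<Sum>k<m * n. cnj (B $$ (k, x)) * B $$ (k, y)) =
      (\<Sum>a<m. \<Sum>c<n. if c = w then (if w = w' then cnj (K $$ (a, u)) * K $$ (a, u') else 0) else 0)"
    unfolding sum_lessThan_mult using * by (intro sum.cong refl) (auto simp: ix)
  also have "\<dots> = (if w = w' then (\<Sum>a<m. cnj (K $$ (a, u)) * K $$ (a, u')) else 0)"
    using * by simp
  also have "\<dots> = (if x = y then 1 else 0)"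
    using K * mult_add_eq_iff[of w n w' u u'] unfolding unitary_mat_iff_columns[OF Kc] by auto
  finally show "(\<Sum>k<m * n. cnj (B $$ (k, x)) * B $$ (k, y)) = (if x = y then 1 else 0)" .
qed

lemma unitary_mat_tensor_right:
  assumes B: "B \<in> carrier_mat (m * n) (m * n)" and K: "unitary_mat n K"
    and ix: "\<And>u u' w w'. u < m \<Longrightarrow> u' < m \<Longrightarrow> w < n \<Longrightarrow> w' < n \<Longrightarrow>
      B $$ (u * n + w, u' * n + w') = (if u = u' then K $$ (w, w') else 0)"
  shows "unitary_mat (m * n) B"
  unfolding unitary_mat_iff_columns[OF B]
proof (intro allI impI)
  fix x y assume "x < m * n" "y < m * n"
  then obtain u w u' w' where *: "u < m" "w < n" "x = u * n + w" "u' < m" "w' < n" "y = u' * n + w'"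
    by (elim less_mult_obtain)
  have Kc: "K \<in> carrier_mat n n" using K by (rule unitary_mat_carrier)
  have "(\<Sum>k<m * n. cnj (B $$ (k, x)) * B $$ (k, y)) =
      (\<Sum>a<m. if a = u then (\<Sum>c<n. if u = u' then cnj (K $$ (c, w)) * K $$ (c, w') else 0) else 0)"
    unfolding sum_lessThan_mult using * by (intro sum.cong refl) (auto simp: ix intro!: sum.cong)
  also have "\<dots> = (if u = u' then (\<Sum>c<n. cnj (K $$ (c, w)) * K $$ (c, w')) else 0)"
    using * by simp
  also have "\<dots> = (if x = y then 1 else 0)"
    using K * mult_add_eq_iff[of w n w' u u'] unfolding unitary_mat_iff_columns[OF Kc] by auto
  finally show "(\<Sum>k<m * n. cnj (B $$ (k, x)) * B $$ (k, y)) = (if x = y then 1 else 0)" .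
qed

text \<open>The gate index \<open>k * d + l\<close> is already the base-\<open>d\<close> index of a
  chain of length two, and no site lies off the bond.\<close>

lemma bond_op_two:
  assumes "A \<in> carrier_mat (d\<^sup>2) (d\<^sup>2)"
  shows "bond_op d 2 1 A = A"
proof (rule eq_matI)
  fix x y assume "x < dim_row A" "y < dim_col A"
  hence *: "x < d ^ 2" "y < d ^ 2" using assms by auto
  have "digit d 2 x 1 * d + digit d 2 x (1 + 1) = x" if "x < d ^ 2" for x
  proof -
    have "x div d < d" using that by (simp add: less_mult_imp_div_less power2_eq_square)
    thus ?thesis by (simp add: digit_def)
  qed
  moreover have "{1..2} - {1, 1 + 1} = ({} :: nat set)" by auto
  ultimately show "bond_op d 2 1 A $$ (x, y) = A $$ (x, y)"
    using * by (simp add: index_bond_op)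
qed (use assms in \<open>auto simp: bond_op_def\<close>)

lemma unitary_bond_op:
  assumes A: "unitary_mat (d\<^sup>2) A" and j: "1 \<le> j" "j < N"
  shows "unitary_mat (d ^ N) (bond_op d N j A)"
proof -
  \<comment> \<open>\<open>m\<close> sites lie to the left of the bond and \<open>n\<close> to its
    right. The identity on the right sites is attached first, then the one on the left
    sites.\<close>
  define m n where "m = j - 1" and "n = N - j - 1"
  have N: "N = m + (2 + n)" and jm: "j = m + 1" using j by (auto simp: m_def n_def)
  have "unitary_mat (d\<^sup>2 * d ^ n) (bond_op d (2 + n) 1 A)"
  proof (rule unitary_mat_tensor_left[OF _ A])
    fix u u' w w' assume "u < d\<^sup>2" "u' < d\<^sup>2" "w < d ^ n" "w' < d ^ n"
    thus "bond_op d (2 + n) 1 A $$ (u * d ^ n + w, u' * d ^ n + w') = (if w = w' then A $$ (u, u') else 0)"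
      using index_bond_op_left[of u d 2 w n u' w' 1 A] bond_op_two[OF unitary_mat_carrier[OF A]] by simp
  next
    show "bond_op d (2 + n) 1 A \<in> carrier_mat (d\<^sup>2 * d ^ n) (d\<^sup>2 * d ^ n)"
      using bond_op_carrier[of d "2 + n" 1 A] by (simp only: power_add)
  qed
  hence "unitary_mat (d ^ (2 + n)) (bond_op d (2 + n) 1 A)" by (simp only: power_add)
  hence "unitary_mat (d ^ m * d ^ (2 + n)) (bond_op d (m + (2 + n)) (m + 1) A)"
  proof (rule unitary_mat_tensor_right[rotated])
    fix u u' w w' assume "u < d ^ m" "u' < d ^ m" "w < d ^ (2 + n)" "w' < d ^ (2 + n)"
    thus "bond_op d (m + (2 + n)) (m + 1) A $$ (u * d ^ (2 + n) + w, u' * d ^ (2 + n) + w') =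
      (if u = u' then bond_op d (2 + n) 1 A $$ (w, w') else 0)"
      by (intro index_bond_op_right) auto
  next
    show "bond_op d (m + (2 + n)) (m + 1) A \<in> carrier_mat (d ^ m * d ^ (2 + n)) (d ^ m * d ^ (2 + n))"
      using bond_op_carrier[of d "m + (2 + n)" "m + 1" A] by (simp only: power_add)
  qed
  thus ?thesis by (simp only: N jm power_add)
qed

section \<open>Tensor products of vectors\<close>

definition tensor :: "complex vec \<Rightarrow> complex vec \<Rightarrow> complex vec" where
  "tensor x y = Matrix.vec (dim_vec x * dim_vec y) (\<lambda>i. x $ (i div dim_vec y) * y $ (i mod dim_vec y))"

text \<open>The first factor carries the high part of the index, hence the sites on the left, in
  agreement with \<open>digit_upper\<close>.\<close>

lemma index_tensor:
  "u < dim_vec x \<Longrightarrow> w < dim_vec y \<Longrightarrow> tensor x y $ (u * dim_vec y + w) = x $ u * y $ w"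
  by (cases "dim_vec y = 0") (simp_all add: tensor_def mult_add_less)

lemma dim_tensor [simp]: "dim_vec (tensor x y) = dim_vec x * dim_vec y"
  by (simp add: tensor_def)

lemma tensor_eqI:
  assumes "dim_vec v = dim_vec x * dim_vec y"
    and "\<And>u w. u < dim_vec x \<Longrightarrow> w < dim_vec y \<Longrightarrow> v $ (u * dim_vec y + w) = x $ u * y $ w"
  shows "v = tensor x y"
  by (rule eq_vecI) (use assms in \<open>auto simp: index_tensor elim!: less_mult_obtain\<close>)

lemma vnorm_tensor: "vnorm (tensor x y) = vnorm x * vnorm y"
proof -
  have "(vnorm (tensor x y))\<^sup>2 = (vnorm x)\<^sup>2 * (vnorm y)\<^sup>2"
    by (simp add: vnorm_power2 sum_lessThan_mult index_tensor norm_mult power_mult_distrib sum_product)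
  thus ?thesis by (simp add: power_mult_distrib[symmetric])
qed

lemma bond_op_tensor_left:
  assumes "x \<in> carrier_vec (d ^ m)" "y \<in> carrier_vec (d ^ n)" "j + 1 \<le> m"
  shows "bond_op d (m + n) j A *\<^sub>v tensor x y = tensor (bond_op d m j A *\<^sub>v x) y"
proof (rule tensor_eqI)
  let ?B = "bond_op d m j A"
  have Bc: "?B \<in> carrier_mat (d ^ m) (d ^ m)" "bond_op d (m + n) j A \<in> carrier_mat (d ^ (m + n)) (d ^ (m + n))"
    by simp_all
  show "dim_vec (bond_op d (m + n) j A *\<^sub>v tensor x y) = dim_vec (?B *\<^sub>v x) * dim_vec y"
    using assms Bc by (simp add: power_add bond_op_def)
  fix u w assume "u < dim_vec (?B *\<^sub>v x)" "w < dim_vec y"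
  hence uw: "u < d ^ m" "w < d ^ n" using assms by (auto simp: bond_op_def)
  hence lt: "u * d ^ n + w < d ^ (m + n)" by (simp add: power_add mult_add_less)
  have "(bond_op d (m + n) j A *\<^sub>v tensor x y) $ (u * d ^ n + w) =
      (\<Sum>u'<d ^ m. \<Sum>w'<d ^ n. bond_op d (m + n) j A $$ (u * d ^ n + w, u' * d ^ n + w') *
        tensor x y $ (u' * d ^ n + w'))"
    using lt assms Bc by (subst index_mult_mat_vec_sum) (auto simp: power_add sum_lessThan_mult)
  also have "\<dots> = (\<Sum>u'<d ^ m. \<Sum>w'<d ^ n. if w = w' then ?B $$ (u, u') * x $ u' * y $ w else 0)"
    using assms uw index_tensor[of _ x _ y] by (intro sum.cong refl) (auto simp: index_bond_op_left)
  also have "\<dots> = (?B *\<^sub>v x) $ u * y $ w"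
    using uw assms Bc by (simp add: index_mult_mat_vec_sum sum_distrib_right del: index_mult_mat_vec)
  finally show "(bond_op d (m + n) j A *\<^sub>v tensor x y) $ (u * dim_vec y + w) = (?B *\<^sub>v x) $ u * y $ w"
    using assms by simp
qed

lemma bond_op_tensor_right:
  assumes "x \<in> carrier_vec (d ^ m)" "y \<in> carrier_vec (d ^ n)" "1 \<le> j" "j + 1 \<le> n"
  shows "bond_op d (m + n) (m + j) A *\<^sub>v tensor x y = tensor x (bond_op d n j A *\<^sub>v y)"
proof (rule tensor_eqI)
  let ?B = "bond_op d n j A"
  have Bc: "?B \<in> carrier_mat (d ^ n) (d ^ n)"
    "bond_op d (m + n) (m + j) A \<in> carrier_mat (d ^ (m + n)) (d ^ (m + n))"
    by simp_all
  show "dim_vec (bond_op d (m + n) (m + j) A *\<^sub>v tensor x y) = dim_vec x * dim_vec (?B *\<^sub>v y)"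
    using assms Bc by (simp add: power_add bond_op_def)
  fix u w assume "u < dim_vec x" "w < dim_vec (?B *\<^sub>v y)"
  hence uw: "u < d ^ m" "w < d ^ n" using assms by (auto simp: bond_op_def)
  hence lt: "u * d ^ n + w < d ^ (m + n)" by (simp add: power_add mult_add_less)
  have "(bond_op d (m + n) (m + j) A *\<^sub>v tensor x y) $ (u * d ^ n + w) =
      (\<Sum>u'<d ^ m. \<Sum>w'<d ^ n. bond_op d (m + n) (m + j) A $$ (u * d ^ n + w, u' * d ^ n + w') *
        tensor x y $ (u' * d ^ n + w'))"
    using lt assms Bc by (subst index_mult_mat_vec_sum) (auto simp: power_add sum_lessThan_mult)
  also have "\<dots> = (\<Sum>u'<d ^ m. if u = u' then (\<Sum>w'<d ^ n. x $ u * (?B $$ (w, w') * y $ w')) else 0)"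
    using assms uw index_tensor[of _ x _ y] by (intro sum.cong refl) (auto simp: index_bond_op_right mult_ac intro!: sum.cong)
  also have "\<dots> = x $ u * (?B *\<^sub>v y) $ w"
    using uw assms Bc by (simp add: index_mult_mat_vec_sum sum_distrib_left del: index_mult_mat_vec)
  finally show "(bond_op d (m + n) (m + j) A *\<^sub>v tensor x y) $ (u * dim_vec (?B *\<^sub>v y) + w) =
      x $ u * (?B *\<^sub>v y) $ w"
    by (simp add: bond_op_def)
qed

section \<open>Charge as a diagonal operator\<close>

lemma site_op_mat_diag:
  assumes "0 < d" "1 \<le> i" "i \<le> N"
  shows "site_op d N i (mat_diag d f) = mat_diag (d ^ N) (\<lambda>x. f (digit d N x i))"
proof (rule eq_matI)
  fix x y assume "x < dim_row (mat_diag (d ^ N) (\<lambda>x. f (digit d N x i)))"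
    "y < dim_col (mat_diag (d ^ N) (\<lambda>x. f (digit d N x i)))"
  hence xy: "x < d ^ N" "y < d ^ N" by (auto simp: mat_diag_def)
  have "x = y" if "\<forall>j\<in>{1..N} - {i}. digit d N x j = digit d N y j" "digit d N x i = digit d N y i"
    using xy that by (intro digit_eqI[of x d N y]) auto
  thus "site_op d N i (mat_diag d f) $$ (x, y) = mat_diag (d ^ N) (\<lambda>x. f (digit d N x i)) $$ (x, y)"
    using xy assms(1) by (auto simp: site_op_def mat_diag_def digit_less)
qed (auto simp: site_op_def mat_diag_def)

text \<open>The offset \<open>(d - 1) / 2\<close> cancels against the one in the spin, so only the
  digit is left.\<close>

lemma charge_eq_mat_diag:
  assumes "0 < d" "1 \<le> i" "i \<le> N"
  shows "charge d N i = mat_diag (d ^ N) (\<lambda>x. of_nat (digit d N x i))"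
  unfolding charge_def spin_z_def site_op_mat_diag[OF assms]
  by (rule eq_matI) (auto simp: mat_diag_def)

section \<open>Decoupling the circuit at the cut\<close>

lemma smult_mat_mult_vec:
  fixes A :: "'a::comm_semiring_0 mat"
  assumes "A \<in> carrier_mat n m" "v \<in> carrier_vec m"
  shows "(a \<cdot>\<^sub>m A) *\<^sub>v v = a \<cdot>\<^sub>v (A *\<^sub>v v)"
  using assms by (intro eq_vecI) (auto simp: scalar_prod_def sum_distrib_left mult.assoc)

text \<open>On the range of \<open>P\<close> both unitaries agree, so only the defect
  \<open>v - P v\<close> contributes, once through each isometry; hence the factor 2.\<close>

lemma vnorm_unitary_diff_le:
  assumes S: "unitary_mat n S" "unitary_mat n S'" and P: "P \<in> carrier_mat n n"
    and SP: "S * P = S' * P" and v: "v \<in> carrier_vec n"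
  shows "vnorm (S *\<^sub>v v - S' *\<^sub>v v) \<le> 2 * vnorm (v - P *\<^sub>v v)"
proof -
  have c: "S \<in> carrier_mat n n" "S' \<in> carrier_mat n n" using S by (auto simp: unitary_mat_def)
  have Pv: "P *\<^sub>v v \<in> carrier_vec n" using P v by simp
  have e: "S *\<^sub>v (P *\<^sub>v v) = S' *\<^sub>v (P *\<^sub>v v)"
    unfolding assoc_mult_mat_vec[OF c(1) P v, symmetric] assoc_mult_mat_vec[OF c(2) P v, symmetric] SP ..
  have "S *\<^sub>v v - S' *\<^sub>v v = (S *\<^sub>v v - S *\<^sub>v (P *\<^sub>v v)) - (S' *\<^sub>v v - S' *\<^sub>v (P *\<^sub>v v))"
    unfolding e using c Pv v by (intro eq_vecI) auto
  also have "\<dots> = S *\<^sub>v (v - P *\<^sub>v v) - S' *\<^sub>v (v - P *\<^sub>v v)"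
    using c Pv v by (simp add: mult_minus_distrib_mat_vec[of _ n n])
  finally have "vnorm (S *\<^sub>v v - S' *\<^sub>v v) = vnorm (S *\<^sub>v (v - P *\<^sub>v v) - S' *\<^sub>v (v - P *\<^sub>v v))"
    by simp
  also have "\<dots> \<le> vnorm (S *\<^sub>v (v - P *\<^sub>v v)) + vnorm (S' *\<^sub>v (v - P *\<^sub>v v))"
    using c by (intro vnorm_minus_le) simp
  also have "\<dots> = 2 * vnorm (v - P *\<^sub>v v)"
    using S Pv v by (simp add: unitary_vnorm)
  finally show ?thesis .
qed

text \<open>A unitary commuting with \<open>P\<close> carries the defect of \<open>v\<close> to the
  defect of its image. Later this transfers a bound known after a sublayer to the state before
  it.\<close>

lemma vnorm_unitary_commute:
  assumes S: "unitary_mat n S" and P: "P \<in> carrier_mat n n"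
    and SP: "S * P = P * S" and v: "v \<in> carrier_vec n"
  shows "vnorm (S *\<^sub>v v - P *\<^sub>v (S *\<^sub>v v)) = vnorm (v - P *\<^sub>v v)"
proof -
  have c: "S \<in> carrier_mat n n" using S by (auto simp: unitary_mat_def)
  have Pv: "P *\<^sub>v v \<in> carrier_vec n" using P v by simp
  have "P *\<^sub>v (S *\<^sub>v v) = S *\<^sub>v (P *\<^sub>v v)"
    unfolding assoc_mult_mat_vec[OF c P v, symmetric] assoc_mult_mat_vec[OF P c v, symmetric] SP ..
  hence "S *\<^sub>v v - P *\<^sub>v (S *\<^sub>v v) = S *\<^sub>v (v - P *\<^sub>v v)"
    using c Pv v by (simp add: mult_minus_distrib_mat_vec[of _ n n])
  thus ?thesis using S Pv v by (simp add: unitary_vnorm)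
qed

section \<open>Products of gates\<close>

lemma mat_prod_Cons [simp]: "mat_prod n (A # As) = A * mat_prod n As"
  and mat_prod_Nil [simp]: "mat_prod n [] = 1\<^sub>m n"
  by (simp_all add: mat_prod_def)

lemma mat_prod_carrier:
  "(\<And>A. A \<in> set As \<Longrightarrow> A \<in> carrier_mat n n) \<Longrightarrow> mat_prod n As \<in> carrier_mat n n"
  by (induction As) auto

lemma unitary_mat_prod:
  "(\<And>A. A \<in> set As \<Longrightarrow> unitary_mat n A) \<Longrightarrow> unitary_mat n (mat_prod n As)"
  by (induction As) (auto intro: unitary_mat_one unitary_mat_mult)

lemma mat_prod_commute:
  assumes "P \<in> carrier_mat n n" "\<And>j. j \<in> set js \<Longrightarrow> f j \<in> carrier_mat n n"
    and "\<And>j. j \<in> set js \<Longrightarrow> f j * P = P * f j"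
  shows "mat_prod n (map f js) * P = P * mat_prod n (map f js)"
  using assms(2,3)
proof (induction js)
  case (Cons j js)
  have c: "mat_prod n (map f js) \<in> carrier_mat n n" "f j \<in> carrier_mat n n"
    using Cons.prems by (auto intro!: mat_prod_carrier)
  have IH: "mat_prod n (map f js) * P = P * mat_prod n (map f js)" using Cons by auto
  have "f j * mat_prod n (map f js) * P = f j * (mat_prod n (map f js) * P)"
    by (rule assoc_mult_mat[OF c(2,1) assms(1)])
  also have "\<dots> = f j * P * mat_prod n (map f js)"
    unfolding IH by (rule assoc_mult_mat[OF c(2) assms(1) c(1), symmetric])
  also have "f j * P = P * f j" by (rule Cons.prems(2)) simp
  also have "P * f j * mat_prod n (map f js) = P * (f j * mat_prod n (map f js))"
    by (rule assoc_mult_mat[OF assms(1) c(2,1)])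
  finally show ?case by simp
qed (use assms(1) in simp)

text \<open>The factors are exchanged one at a time: \<open>P\<close> is moved left past the factors
  already turned into \<open>g\<close>, turns the next \<open>f j\<close> into \<open>g j\<close>,
  and is moved back to the right end.\<close>

lemma mat_prod_mult_cong:
  assumes "P \<in> carrier_mat n n"
    and "\<And>j. j \<in> set js \<Longrightarrow> f j \<in> carrier_mat n n" "\<And>j. j \<in> set js \<Longrightarrow> g j \<in> carrier_mat n n"
    and "\<And>j. j \<in> set js \<Longrightarrow> g j * P = P * g j" "\<And>j. j \<in> set js \<Longrightarrow> f j * P = g j * P"
  shows "mat_prod n (map f js) * P = mat_prod n (map g js) * P"
  using assms(2-5)
proof (induction js)
  case (Cons j js)
  let ?F = "mat_prod n (map f js)" and ?G = "mat_prod n (map g js)"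
  have c: "?F \<in> carrier_mat n n" "f j \<in> carrier_mat n n" "?G \<in> carrier_mat n n" "g j \<in> carrier_mat n n"
    using Cons.prems by (auto intro!: mat_prod_carrier)
  have comm: "?G * P = P * ?G"
    using Cons.prems assms(1) by (intro mat_prod_commute) auto
  have IH: "?F * P = ?G * P" using Cons by auto
  have "f j * ?F * P = f j * (?F * P)" by (rule assoc_mult_mat[OF c(2,1) assms(1)])
  also have "\<dots> = f j * P * ?G"
    unfolding IH comm by (rule assoc_mult_mat[OF c(2) assms(1) c(3), symmetric])
  also have "f j * P = g j * P" by (rule Cons.prems(4)) simp
  also have "g j * P * ?G = g j * (P * ?G)" by (rule assoc_mult_mat[OF c(4) assms(1) c(3)])
  also have "\<dots> = g j * ?G * P"
    unfolding comm[symmetric] by (rule assoc_mult_mat[OF c(4,3) assms(1), symmetric])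
  finally show ?case by simp
qed simp

section \<open>The projector onto \<open>|00>\<close> at the two sites next to the cut\<close>

definition cut_proj :: "nat \<Rightarrow> nat \<Rightarrow> nat \<Rightarrow> complex mat" where
  "cut_proj d N h = mat_diag (d ^ N) (\<lambda>x. if digit d N x h = 0 \<and> digit d N x (h + 1) = 0 then 1 else 0)"

lemma cut_proj_carrier [simp]: "cut_proj d N h \<in> carrier_mat (d ^ N) (d ^ N)"
  by (simp add: cut_proj_def)

lemma mat_diag_commute:
  fixes A :: "'a::comm_semiring_1 mat"
  assumes A: "A \<in> carrier_mat n n"
    and f: "\<And>x y. x < n \<Longrightarrow> y < n \<Longrightarrow> A $$ (x, y) \<noteq> 0 \<Longrightarrow> f x = f y"
  shows "A * mat_diag n f = mat_diag n f * A"
proof (rule eq_matI)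
  fix x y assume "x < dim_row (mat_diag n f * A)" "y < dim_col (mat_diag n f * A)"
  hence xy: "x < n" "y < n" using A by (auto simp: mat_diag_def)
  have "A $$ (x, y) * f y = f x * A $$ (x, y)"
    using f[OF xy] by (cases "A $$ (x, y) = 0") (auto simp: mult.commute)
  thus "(A * mat_diag n f) $$ (x, y) = (mat_diag n f * A) $$ (x, y)"
    unfolding mat_diag_mult_left[OF A] mat_diag_mult_right[OF A] using xy by simp
qed (use A in \<open>auto simp: mat_diag_def\<close>)

text \<open>A gate away from sites \<open>h\<close> and \<open>h + 1\<close> leaves their digits
  unchanged, and the projector depends on these digits only.\<close>

lemma bond_op_cut_proj_commute:
  assumes jh: "{j, j + 1} \<inter> {h, h + 1} = {}" and h: "1 \<le> h" "h < N"
  shows "bond_op d N j A * cut_proj d N h = cut_proj d N h * bond_op d N j A"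
  unfolding cut_proj_def
proof (rule mat_diag_commute[OF bond_op_carrier])
  fix x y assume xy: "x < d ^ N" "y < d ^ N" and nz: "bond_op d N j A $$ (x, y) \<noteq> 0"
  have "\<forall>i\<in>{1..N} - {j, j + 1}. digit d N x i = digit d N y i"
    using nz unfolding index_bond_op[OF xy] by (auto split: if_splits)
  moreover have "h \<in> {1..N} - {j, j + 1}" "h + 1 \<in> {1..N} - {j, j + 1}" using jh h by auto
  ultimately have "digit d N x h = digit d N y h" "digit d N x (h + 1) = digit d N y (h + 1)" by blast+
  thus "(if digit d N x h = 0 \<and> digit d N x (h + 1) = 0 then 1 else 0 :: complex) =
      (if digit d N y h = 0 \<and> digit d N y (h + 1) = 0 then 1 else 0)" by simp
qed

lemma bond_op_smult_one:
  assumes "1 \<le> j" "j < N" "0 < d"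
  shows "bond_op d N j (z \<cdot>\<^sub>m 1\<^sub>m (d\<^sup>2)) = z \<cdot>\<^sub>m 1\<^sub>m (d ^ N)"
proof (rule eq_matI)
  fix x y assume "x < dim_row (z \<cdot>\<^sub>m 1\<^sub>m (d ^ N))" "y < dim_col (z \<cdot>\<^sub>m 1\<^sub>m (d ^ N))"
  hence xy: "x < d ^ N" "y < d ^ N" by auto
  have lt: "digit d N u i * d + digit d N u (i + 1) < d\<^sup>2" for u i
    unfolding power2_eq_square by (intro mult_add_less digit_less assms)
  have "x = y" if off: "\<forall>i\<in>{1..N} - {j, j + 1}. digit d N x i = digit d N y i"
    and eq: "digit d N x j * d + digit d N x (j + 1) = digit d N y j * d + digit d N y (j + 1)"
  proof (rule digit_eqI[OF xy])
    have "digit d N x j = digit d N y j \<and> digit d N x (j + 1) = digit d N y (j + 1)"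
      using eq digit_less[OF assms(3)]
        mult_add_eq_iff[of "digit d N x (j + 1)" d "digit d N y (j + 1)" "digit d N x j" "digit d N y j"] by simp
    thus "digit d N x i = digit d N y i" if "1 \<le> i" "i \<le> N" for i
      using off that by (cases "i \<in> {j, j + 1}") auto
  qed
  thus "bond_op d N j (z \<cdot>\<^sub>m 1\<^sub>m (d\<^sup>2)) $$ (x, y) = (z \<cdot>\<^sub>m 1\<^sub>m (d ^ N)) $$ (x, y)"
    unfolding index_bond_op[OF xy] using xy lt[of x j] lt[of y j] by auto
qed auto

text \<open>The left side is the weight of the basis states with a nonzero digit at \<open>h\<close>
  or \<open>h + 1\<close>. Charges are nonnegative integers, so on these states the total charge of
  the two sites is at least 1.\<close>

lemma vnorm_cut_proj_le_charge:
  assumes "0 < d" "1 \<le> h" "h < N" and v: "v \<in> carrier_vec (d ^ N)"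
  shows "(vnorm (v - cut_proj d N h *\<^sub>v v))\<^sup>2 \<le> expect (charge d N h) v + expect (charge d N (h + 1)) v"
proof -
  have ex: "expect (charge d N i) v = (\<Sum>x<d ^ N. real (digit d N x i) * (cmod (v $ x))\<^sup>2)"
    if "1 \<le> i" "i \<le> N" for i
  proof -
    have "(charge d N i *\<^sub>v v) \<bullet>c v = (\<Sum>x<d ^ N. of_nat (digit d N x i) * (v $ x * cnj (v $ x)))"
      unfolding charge_eq_mat_diag[OF assms(1) that] mat_diag_mult_vec[OF v]
      using v by (simp add: cscalar_prod_sum mult.assoc)
    also have "\<dots> = complex_of_real (\<Sum>x<d ^ N. real (digit d N x i) * (cmod (v $ x))\<^sup>2)"
      unfolding of_real_sum of_real_mult complex_norm_square by simp
    finally show ?thesis by (simp add: expect_def)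
  qed
  have "(vnorm (v - cut_proj d N h *\<^sub>v v))\<^sup>2 =
      (\<Sum>x<d ^ N. if digit d N x h = 0 \<and> digit d N x (h + 1) = 0 then 0 else (cmod (v $ x))\<^sup>2)"
    using v by (auto simp: vnorm_power2 cut_proj_def mat_diag_mult_vec[OF v] intro!: sum.cong)
  also have "\<dots> \<le> (\<Sum>x<d ^ N. (real (digit d N x h) + real (digit d N x (h + 1))) * (cmod (v $ x))\<^sup>2)"
  proof (rule sum_mono)
    fix x
    show "(if digit d N x h = 0 \<and> digit d N x (h + 1) = 0 then 0 else (cmod (v $ x))\<^sup>2)
        \<le> (real (digit d N x h) + real (digit d N x (h + 1))) * (cmod (v $ x))\<^sup>2"
    proof (cases "digit d N x h = 0 \<and> digit d N x (h + 1) = 0")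
      case False
      hence "1 \<le> real (digit d N x h) + real (digit d N x (h + 1))" by linarith
      from mult_right_mono[OF this, of "(cmod (v $ x))\<^sup>2"] show ?thesis using False by simp
    qed simp
  qed
  also have "\<dots> = expect (charge d N h) v + expect (charge d N (h + 1)) v"
    using assms by (simp add: ex ring_distribs sum.distrib)
  finally show ?thesis .
qed

lemma unitary_smult_one: "cmod z = 1 \<Longrightarrow> unitary_mat n (z \<cdot>\<^sub>m 1\<^sub>m n)"
proof -
  assume z: "cmod z = 1"
  have "cnj z * z = 1" "z * cnj z = 1" using z complex_norm_square[of z] by (simp_all add: mult.commute)
  moreover have "mat_adjoint (z \<cdot>\<^sub>m 1\<^sub>m n) = cnj z \<cdot>\<^sub>m 1\<^sub>m n" by (intro eq_matI) auto
  ultimately show ?thesis by (intro unitary_matI) (auto intro!: eq_matI)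
qed

text \<open>The cut lies between sites \<open>h\<close> and \<open>h + 1\<close>; the form
  \<open>N = h + h\<close> fits the lemmas on chains of length \<open>m + n\<close>.\<close>

locale cut_chain =
  fixes d N h :: nat and G :: "nat \<Rightarrow> nat \<Rightarrow> complex mat"
  assumes d: "2 \<le> d" and N: "N = h + h" and circuit: "charge_conserving_circuit d (N, G)"
begin

lemma h_pos: "1 \<le> h" and h_less: "h < N" and d_pos: "0 < d"
  using circuit N d by (auto simp: charge_conserving_circuit_def)

abbreviation P where "P \<equiv> cut_proj d N h"

lemma unitary_gate: "1 \<le> t \<Longrightarrow> 1 \<le> j \<Longrightarrow> j < N \<Longrightarrow> unitary_mat (d\<^sup>2) (G t j)"
  using circuit by (auto simp: charge_conserving_circuit_def)

text \<open>Commuting with the total spin, which is diagonal with values \<open>s\<close>, forces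
  every nonzero entry to join basis states of equal \<open>s\<close>.\<close>

lemma charge_conserved:
  assumes t: "1 \<le> t" and xy: "x < d ^ N" "y < d ^ N" and nz: "bond_op d N h (G t h) $$ (x, y) \<noteq> 0"
  shows "digit d N x h + digit d N x (h + 1) = digit d N y h + digit d N y (h + 1)"
proof -
  define s where "s x = complex_of_real ((real d - 1) / 2 - real (digit d N x h)) +
    complex_of_real ((real d - 1) / 2 - real (digit d N x (h + 1)))" for x
  have S: "spin_z d N h + spin_z d N (h + 1) = mat_diag (d ^ N) s"
    using h_pos h_less d_pos unfolding spin_z_def
    by (subst (1 2) site_op_mat_diag) (auto simp: s_def mat_diag_def intro!: eq_matI)
  let ?B = "bond_op d N h (G t h)"
  have "?B * mat_diag (d ^ N) s = mat_diag (d ^ N) s * ?B"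
    using circuit t h_pos h_less unfolding S[symmetric] by (auto simp: charge_conserving_circuit_def)
  hence "(?B * mat_diag (d ^ N) s) $$ (x, y) = (mat_diag (d ^ N) s * ?B) $$ (x, y)" by simp
  hence "?B $$ (x, y) * s y = s x * ?B $$ (x, y)"
    unfolding mat_diag_mult_left[OF bond_op_carrier] mat_diag_mult_right[OF bond_op_carrier] using xy by simp
  hence "s x = s y" using nz by simp
  hence "complex_of_real (real (digit d N x h + digit d N x (h + 1))) =
      complex_of_real (real (digit d N y h + digit d N y (h + 1)))"
    by (simp add: s_def algebra_simps)
  thus ?thesis by (simp only: of_real_eq_iff of_nat_eq_iff)
qed

text \<open>The amplitude for \<open>|00>\<close> to stay \<open>|00>\<close> under the gate at the
  cut; its modulus is shown to be 1 below.\<close>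

definition phase :: "nat \<Rightarrow> complex" where "phase t = G t h $$ (0, 0)"

text \<open>The gates of the decoupled evolution \<open>U'\<close>.\<close>

definition G' :: "nat \<Rightarrow> nat \<Rightarrow> complex mat" where
  "G' t j = (if j = h then phase t \<cdot>\<^sub>m 1\<^sub>m (d\<^sup>2) else G t j)"

text \<open>\<open>|00>\<close> is the only two-site basis state of total charge 0, so a
  charge-conserving gate maps it to a multiple of itself and mixes nothing else into it.\<close>

lemma bond_op_P:
  assumes t: "1 \<le> t"
  shows "bond_op d N h (G t h) * P = phase t \<cdot>\<^sub>m P"
    and "bond_op d N h (G t h) * P = P * bond_op d N h (G t h)"
proof -
  let ?B = "bond_op d N h (G t h)" and ?p = "\<lambda>x. digit d N x h = 0 \<and> digit d N x (h + 1) = 0"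
  have eq: "x = y" if xy: "x < d ^ N" "y < d ^ N" and nz: "?B $$ (x, y) \<noteq> 0" and p: "?p y" for x y
  proof (rule digit_eqI[OF xy])
    have "?p x" using charge_conserved[OF t xy nz] p by simp
    moreover have "\<forall>i\<in>{1..N} - {h, h + 1}. digit d N x i = digit d N y i"
      using nz unfolding index_bond_op[OF xy] by (auto split: if_splits)
    ultimately show "digit d N x i = digit d N y i" if "1 \<le> i" "i \<le> N" for i
      using p that by (cases "i \<in> {h, h + 1}") auto
  qed
  have diag: "?B $$ (y, y) = phase t" if "y < d ^ N" "?p y" for y
    using that by (simp add: index_bond_op phase_def)
  show "?B * P = phase t \<cdot>\<^sub>m P"
    unfolding cut_proj_def mat_diag_mult_right[OF bond_op_carrier]
  proof (rule eq_matI)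
    fix x y assume "x < dim_row (phase t \<cdot>\<^sub>m mat_diag (d ^ N) (\<lambda>x. if ?p x then 1 else 0))"
      "y < dim_col (phase t \<cdot>\<^sub>m mat_diag (d ^ N) (\<lambda>x. if ?p x then 1 else 0))"
    hence xy: "x < d ^ N" "y < d ^ N" by (auto simp: mat_diag_def)
    show "Matrix.mat (d ^ N) (d ^ N) (\<lambda>(i, j). ?B $$ (i, j) * (if ?p j then 1 else 0)) $$ (x, y) =
      (phase t \<cdot>\<^sub>m mat_diag (d ^ N) (\<lambda>x. if ?p x then 1 else 0)) $$ (x, y)"
      using xy eq[OF xy] diag[OF xy(2)] by (auto simp: mat_diag_def)
  qed (auto simp: mat_diag_def)
  show "?B * P = P * ?B"
    unfolding cut_proj_def
  proof (rule mat_diag_commute[OF bond_op_carrier])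
    fix x y assume "x < d ^ N" "y < d ^ N" "?B $$ (x, y) \<noteq> 0"
    hence "?p x \<longleftrightarrow> ?p y" using charge_conserved[OF t] by fastforce
    thus "(if ?p x then 1 else 0 :: complex) = (if ?p y then 1 else 0)" by simp
  qed
qed

text \<open>The all-zero basis state is fixed by \<open>P\<close>, so the unitary gate multiplies
  this unit vector by the phase.\<close>

lemma cmod_phase:
  assumes t: "1 \<le> t"
  shows "cmod (phase t) = 1"
proof -
  let ?B = "bond_op d N h (G t h)" and ?e = "unit_vec (d ^ N) 0 :: complex vec"
  have e: "?e \<in> carrier_vec (d ^ N)" by simp
  have nz: "0 < d ^ N" using d_pos by simp
  have Pe: "P *\<^sub>v ?e = ?e"
  proof (rule eq_vecI)
    fix i assume "i < dim_vec ?e"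
    hence i: "i < d ^ N" by simp
    have "?e $ i = (if i = 0 then 1 else 0)" by (rule index_unit_vec(1)[OF nz i])
    thus "(P *\<^sub>v ?e) $ i = ?e $ i"
      unfolding cut_proj_def mat_diag_mult_vec[OF e] using i by (cases "i = 0") (simp_all add: digit_def)
  qed (simp add: cut_proj_def mat_diag_def)
  have n1: "vnorm ?e = 1"
  proof -
    have "(vnorm ?e)\<^sup>2 = (\<Sum>i<d ^ N. if i = 0 then 1 else 0)"
      unfolding vnorm_power2 by (intro sum.cong) (auto simp: index_unit_vec(1)[OF nz])
    also have "\<dots> = 1" using d_pos by simp
    finally show ?thesis using vnorm_nonneg[of ?e] by (simp add: power2_eq_1_iff)
  qed
  have "?B *\<^sub>v ?e = (?B * P) *\<^sub>v ?e"
    using Pe by (simp add: assoc_mult_mat_vec[of _ "d ^ N" "d ^ N" _ "d ^ N"])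
  also have "\<dots> = phase t \<cdot>\<^sub>v (P *\<^sub>v ?e)"
    unfolding bond_op_P(1)[OF t] by (rule smult_mat_mult_vec[OF cut_proj_carrier e])
  finally have "vnorm (?B *\<^sub>v ?e) = cmod (phase t)" by (simp add: Pe vnorm_smult n1)
  thus ?thesis using unitary_vnorm[OF unitary_bond_op[OF unitary_gate[OF t]], of h] n1 h_pos h_less by simp
qed

lemma unitary_gate': "1 \<le> t \<Longrightarrow> 1 \<le> j \<Longrightarrow> j < N \<Longrightarrow> unitary_mat (d\<^sup>2) (G' t j)"
  by (simp add: G'_def unitary_gate unitary_smult_one cmod_phase)

section \<open>One layer as two sublayers\<close>

definition sublayer :: "(nat \<Rightarrow> nat \<Rightarrow> complex mat) \<Rightarrow> nat \<Rightarrow> nat list \<Rightarrow> complex mat" where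
  "sublayer H t js = mat_prod (d ^ N) (map (\<lambda>j. bond_op d N j (H t j)) js)"

text \<open>Bonds of equal parity share no site. In a layer the odd bonds act first and the even
  bonds second.\<close>

definition evens :: "nat list" where "evens = map (\<lambda>i. 2 * i) [1..<h]"
definition odds :: "nat list" where "odds = map (\<lambda>i. 2 * i - 1) [1..<h + 1]"

lemma layer_eq_sublayers: "layer d (N, H) t = sublayer H t evens * sublayer H t odds"
proof -
  have "N div 2 = h" using N by simp
  thus ?thesis by (simp only: layer_def sublayer_def evens_def odds_def prod.case map_map o_def)
qed

lemma parity: "j \<in> set evens \<Longrightarrow> even j" "j \<in> set odds \<Longrightarrow> odd j"
  by (auto simp: evens_def odds_def)

lemma bonds: "j \<in> set evens \<union> set odds \<Longrightarrow> 1 \<le> j \<and> j < N"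
  using N by (auto simp: evens_def odds_def)

lemma sublayer_carrier [simp]: "sublayer H t js \<in> carrier_mat (d ^ N) (d ^ N)"
  unfolding sublayer_def by (rule mat_prod_carrier) auto

lemma unitary_sublayer:
  assumes "\<And>j. 1 \<le> j \<Longrightarrow> j < N \<Longrightarrow> unitary_mat (d\<^sup>2) (H t j)" "\<And>j. j \<in> set js \<Longrightarrow> 1 \<le> j \<and> j < N"
  shows "unitary_mat (d ^ N) (sublayer H t js)"
  unfolding sublayer_def using assms by (auto intro!: unitary_mat_prod unitary_bond_op)

text \<open>Every bond of the list is the cut bond or disjoint from its two sites, so
  \<open>P\<close> passes all gates, and in front of \<open>P\<close> the gate at the cut may be
  exchanged for its phase.\<close>

lemma sublayer_P:
  assumes t: "1 \<le> t" and js: "\<And>j. j \<in> set js \<Longrightarrow> j = h \<or> {j, j + 1} \<inter> {h, h + 1} = {}"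
  shows "sublayer G t js * P = P * sublayer G t js"
    and "sublayer G t js * P = sublayer G' t js * P"
proof -
  have comm: "bond_op d N j (G t j) * P = P * bond_op d N j (G t j)" if "j \<in> set js" for j
    using js[OF that] bond_op_P(2)[OF t] bond_op_cut_proj_commute[of j h N d "G t j"] h_pos h_less by auto
  have z: "bond_op d N h (G' t h) = phase t \<cdot>\<^sub>m 1\<^sub>m (d ^ N)"
    using h_pos h_less d_pos by (simp add: G'_def bond_op_smult_one)
  have P1: "(phase t \<cdot>\<^sub>m 1\<^sub>m (d ^ N)) * P = phase t \<cdot>\<^sub>m P" "P * (phase t \<cdot>\<^sub>m 1\<^sub>m (d ^ N)) = phase t \<cdot>\<^sub>m P"
    using mult_smult_assoc_mat[of "1\<^sub>m (d ^ N)" "d ^ N" "d ^ N" P "d ^ N" "phase t"]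
      mult_smult_distrib[of P "d ^ N" "d ^ N" "1\<^sub>m (d ^ N)" "d ^ N" "phase t"]
      left_mult_one_mat[OF cut_proj_carrier[of d N h]] right_mult_one_mat[OF cut_proj_carrier[of d N h]]
    by simp_all
  show "sublayer G t js * P = P * sublayer G t js"
    unfolding sublayer_def using comm by (intro mat_prod_commute) auto
  show "sublayer G t js * P = sublayer G' t js * P"
    unfolding sublayer_def
  proof (rule mat_prod_mult_cong)
    fix j assume j: "j \<in> set js"
    show "bond_op d N j (G' t j) * P = P * bond_op d N j (G' t j)"
      by (cases "j = h") (use z P1 comm[OF j] in \<open>auto simp: G'_def\<close>)
    show "bond_op d N j (G t j) * P = bond_op d N j (G' t j) * P"
      by (cases "j = h") (use z P1 bond_op_P(1)[OF t] in \<open>auto simp: G'_def\<close>)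
  qed auto
qed

lemma sublayer_avoiding_cut: "h \<notin> set js \<Longrightarrow> sublayer G' t js = sublayer G t js"
  unfolding sublayer_def by (intro arg_cong[of _ _ "mat_prod _"] map_cong) (auto simp: G'_def)

lemma unitary_layer:
  assumes "\<And>j. 1 \<le> j \<Longrightarrow> j < N \<Longrightarrow> unitary_mat (d\<^sup>2) (H t j)"
  shows "unitary_mat (d ^ N) (layer d (N, H) t)"
  unfolding layer_eq_sublayers using assms bonds by (intro unitary_mat_mult unitary_sublayer) auto

text \<open>Defects are assumed small only between full layers, and the parity of \<open>h\<close>
  decides which bound is used. For odd \<open>h\<close> the gate at the cut acts in the first
  sublayer and \<open>before\<close> applies. For even \<open>h\<close> it acts in the second, which
  commutes with \<open>P\<close>, so \<open>after\<close> also bounds the defect between the two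
  sublayers.\<close>

lemma layer_diff_le:
  assumes t: "1 \<le> t" and v: "v \<in> carrier_vec (d ^ N)"
    and before: "vnorm (v - P *\<^sub>v v) \<le> \<epsilon>"
    and after: "vnorm (layer d (N, G) t *\<^sub>v v - P *\<^sub>v (layer d (N, G) t *\<^sub>v v)) \<le> \<epsilon>"
  shows "vnorm (layer d (N, G) t *\<^sub>v v - layer d (N, G') t *\<^sub>v v) \<le> 2 * \<epsilon>"
proof -
  let ?E = "sublayer G t evens" and ?O = "sublayer G t odds"
  let ?E' = "sublayer G' t evens" and ?O' = "sublayer G' t odds"
  have u: "unitary_mat (d ^ N) ?E" "unitary_mat (d ^ N) ?O" "unitary_mat (d ^ N) ?E'" "unitary_mat (d ^ N) ?O'"
    using bonds t by (auto intro!: unitary_sublayer unitary_gate unitary_gate')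
  have L: "layer d (N, H) t *\<^sub>v v = sublayer H t evens *\<^sub>v (sublayer H t odds *\<^sub>v v)" for H
    unfolding layer_eq_sublayers using v by (rule assoc_mult_mat_vec[OF sublayer_carrier sublayer_carrier])
  have Ov: "?O *\<^sub>v v \<in> carrier_vec (d ^ N)" "?O' *\<^sub>v v \<in> carrier_vec (d ^ N)"
    using v by (auto intro: mult_mat_vec_carrier[OF sublayer_carrier])
  show ?thesis
  proof (cases "even h")
    case True
    have avoid: "h \<notin> set odds" using True parity by blast
    have js: "j = h \<or> {j, j + 1} \<inter> {h, h + 1} = {}" if "j \<in> set evens" for j
      using parity(1)[OF that] True by auto
    note EP = sublayer_P[OF t js]
    have "vnorm (?E *\<^sub>v (?O *\<^sub>v v) - ?E' *\<^sub>v (?O *\<^sub>v v)) \<le> 2 * vnorm (?O *\<^sub>v v - P *\<^sub>v (?O *\<^sub>v v))"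
      by (rule vnorm_unitary_diff_le[OF u(1,3) cut_proj_carrier EP(2) Ov(1)])
    also have "vnorm (?O *\<^sub>v v - P *\<^sub>v (?O *\<^sub>v v)) = vnorm (?E *\<^sub>v (?O *\<^sub>v v) - P *\<^sub>v (?E *\<^sub>v (?O *\<^sub>v v)))"
      by (rule vnorm_unitary_commute[OF u(1) cut_proj_carrier EP(1) Ov(1), symmetric])
    finally show ?thesis using after by (simp add: L sublayer_avoiding_cut[OF avoid])
  next
    case False
    have avoid: "h \<notin> set evens" using False parity by blast
    have js: "j = h \<or> {j, j + 1} \<inter> {h, h + 1} = {}" if "j \<in> set odds" for j
      using parity(2)[OF that] False by auto
    note OP = sublayer_P[OF t js]
    have "?E *\<^sub>v (?O *\<^sub>v v) - ?E *\<^sub>v (?O' *\<^sub>v v) = ?E *\<^sub>v (?O *\<^sub>v v - ?O' *\<^sub>v v)"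
      using Ov by (simp add: mult_minus_distrib_mat_vec[OF sublayer_carrier])
    hence "vnorm (?E *\<^sub>v (?O *\<^sub>v v) - ?E *\<^sub>v (?O' *\<^sub>v v)) = vnorm (?O *\<^sub>v v - ?O' *\<^sub>v v)"
      using unitary_vnorm[OF u(1), of "?O *\<^sub>v v - ?O' *\<^sub>v v"] Ov by simp
    also have "\<dots> \<le> 2 * vnorm (v - P *\<^sub>v v)"
      by (rule vnorm_unitary_diff_le[OF u(2,4) cut_proj_carrier OP(2) v])
    finally show ?thesis using before by (simp add: L sublayer_avoiding_cut[OF avoid])
  qed
qed

section \<open>Accumulated error of the decoupled evolution\<close>

lemma unitary_evolution:
  assumes "\<And>t j. 1 \<le> t \<Longrightarrow> 1 \<le> j \<Longrightarrow> j < N \<Longrightarrow> unitary_mat (d\<^sup>2) (H t j)"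
  shows "unitary_mat (d ^ N) (evolution d (N, H) t)"
  by (induction t) (auto intro!: unitary_mat_one unitary_mat_mult unitary_layer assms)

text \<open>Each layer adds an error of at most \<open>2 * \<epsilon>\<close>, and earlier errors
  are carried along unchanged because the layers are unitary.\<close>

lemma evolution_diff_le:
  assumes v: "v \<in> carrier_vec (d ^ N)"
    and small: "\<And>s. s \<le> t \<Longrightarrow> vnorm (evolution d (N, G) s *\<^sub>v v - P *\<^sub>v (evolution d (N, G) s *\<^sub>v v)) \<le> \<epsilon>"
  shows "vnorm (evolution d (N, G) t *\<^sub>v v - evolution d (N, G') t *\<^sub>v v) \<le> 2 * real t * \<epsilon>"
  using small
proof (induction t)
  case 0
  have "1\<^sub>m (d ^ N) *\<^sub>v v - 1\<^sub>m (d ^ N) *\<^sub>v v = 0\<^sub>v (d ^ N)" using v by auto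
  thus ?case by simp
next
  case (Suc t)
  define w where "w = evolution d (N, G) t *\<^sub>v v"
  define w' where "w' = evolution d (N, G') t *\<^sub>v v"
  let ?L = "layer d (N, G) (Suc t)" and ?L' = "layer d (N, G') (Suc t)"
  have ev: "evolution d (N, G) s \<in> carrier_mat (d ^ N) (d ^ N)" "evolution d (N, G') s \<in> carrier_mat (d ^ N) (d ^ N)" for s
    by (intro unitary_mat_carrier unitary_evolution unitary_gate unitary_gate'; assumption)+
  have L: "?L \<in> carrier_mat (d ^ N) (d ^ N)" "?L' \<in> carrier_mat (d ^ N) (d ^ N)"
    by (simp_all add: layer_eq_sublayers)
  have uL': "unitary_mat (d ^ N) ?L'" by (intro unitary_layer unitary_gate') auto
  have w: "w \<in> carrier_vec (d ^ N)" "w' \<in> carrier_vec (d ^ N)"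
    using ev v by (auto simp: w_def w'_def intro: mult_mat_vec_carrier)
  have e: "evolution d (N, G) (Suc t) *\<^sub>v v = ?L *\<^sub>v w" "evolution d (N, G') (Suc t) *\<^sub>v v = ?L' *\<^sub>v w'"
    unfolding w_def w'_def evolution.simps
    by (rule assoc_mult_mat_vec[OF L(1) ev(1) v], rule assoc_mult_mat_vec[OF L(2) ev(2) v])
  \<comment> \<open>The intermediate vector \<open>?L' *\<^sub>v w\<close> separates the new error
    of this layer from the old error \<open>w - w'\<close>.\<close>
  have "?L *\<^sub>v w - ?L' *\<^sub>v w' = (?L *\<^sub>v w - ?L' *\<^sub>v w) + (?L' *\<^sub>v w - ?L' *\<^sub>v w')"
    using L w by (intro eq_vecI) auto
  also have "?L' *\<^sub>v w - ?L' *\<^sub>v w' = ?L' *\<^sub>v (w - w')"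
    using L w by (simp add: mult_minus_distrib_mat_vec)
  finally have "vnorm (?L *\<^sub>v w - ?L' *\<^sub>v w') \<le> vnorm (?L *\<^sub>v w - ?L' *\<^sub>v w) + vnorm (?L' *\<^sub>v (w - w'))"
    using L w vnorm_add_le[of "?L *\<^sub>v w - ?L' *\<^sub>v w" "?L' *\<^sub>v (w - w')"] by simp
  also have "vnorm (?L' *\<^sub>v (w - w')) = vnorm (w - w')"
    using w by (intro unitary_vnorm[OF uL']) auto
  also have "\<dots> \<le> 2 * real t * \<epsilon>"
    unfolding w_def w'_def using Suc.prems by (intro Suc.IH) auto
  also have "vnorm (?L *\<^sub>v w - ?L' *\<^sub>v w) \<le> 2 * \<epsilon>"
  proof (rule layer_diff_le)
    show "vnorm (w - P *\<^sub>v w) \<le> \<epsilon>" using Suc.prems[of t] by (simp add: w_def)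
    show "vnorm (?L *\<^sub>v w - P *\<^sub>v (?L *\<^sub>v w)) \<le> \<epsilon>"
      using Suc.prems[of "Suc t"] unfolding e by simp
  qed (use w in auto)
  finally show ?case unfolding e by (simp add: algebra_simps)
qed

section \<open>Products across the cut\<close>

definition product_across :: "complex vec \<Rightarrow> bool" where
  "product_across v \<longleftrightarrow> (\<exists>x\<in>carrier_vec (d ^ h). \<exists>y\<in>carrier_vec (d ^ h). v = tensor x y)"

text \<open>A gate left of the cut acts on the first factor, one right of it on the second, and the
  gate at the cut is a phase, absorbed into the first factor.\<close>

lemma product_across_sublayer:
  assumes "product_across v" "\<And>j. j \<in> set js \<Longrightarrow> 1 \<le> j \<and> j < N"
  shows "product_across (sublayer G' t js *\<^sub>v v)"
  using assms
proof (induction js)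
  case Nil
  then obtain x y where "x \<in> carrier_vec (d ^ h)" "y \<in> carrier_vec (d ^ h)" "v = tensor x y"
    by (auto simp: product_across_def)
  hence "v \<in> carrier_vec (d ^ N)" by (intro carrier_vecI) (simp add: N power_add)
  thus ?case using Nil by (simp add: sublayer_def)
next
  case (Cons j js)
  let ?w = "sublayer G' t js *\<^sub>v v"
  obtain x y where xy: "x \<in> carrier_vec (d ^ h)" "y \<in> carrier_vec (d ^ h)" "?w = tensor x y"
    using Cons by (auto simp: product_across_def)
  obtain x' y' where v: "x' \<in> carrier_vec (d ^ h)" "y' \<in> carrier_vec (d ^ h)" "v = tensor x' y'"
    using Cons.prems by (auto simp: product_across_def)
  have "v \<in> carrier_vec (d ^ N)" using v by (intro carrier_vecI) (simp add: N power_add)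
  hence "sublayer G' t (j # js) *\<^sub>v v = bond_op d N j (G' t j) *\<^sub>v ?w"
    using assoc_mult_mat_vec[OF bond_op_carrier sublayer_carrier] by (simp add: sublayer_def)
  also have "product_across (bond_op d N j (G' t j) *\<^sub>v ?w)"
  proof -
    consider "j < h" | "j = h" | "h < j" by linarith
    thus ?thesis
    proof cases
      case 1
      hence "bond_op d N j (G' t j) *\<^sub>v ?w = tensor (bond_op d h j (G' t j) *\<^sub>v x) y"
        unfolding xy(3) using xy(1,2) by (intro bond_op_tensor_left[of x d h y h j, folded N]) auto
      thus ?thesis using xy(1,2) mult_mat_vec_carrier[OF bond_op_carrier xy(1)]
        unfolding product_across_def by blast
    next
      case 3
      define k where "k = j - h"
      have k: "j = h + k" "1 \<le> k" "k + 1 \<le> h" using 3 Cons.prems(2)[of j] N by (auto simp: k_def)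
      have "bond_op d N j (G' t j) *\<^sub>v ?w = tensor x (bond_op d h k (G' t j) *\<^sub>v y)"
        unfolding xy(3) k(1) using xy(1,2) k(2,3)
        by (intro bond_op_tensor_right[of x d h y h k, folded N]) auto
      thus ?thesis using xy(1,2) mult_mat_vec_carrier[OF bond_op_carrier xy(2)]
        unfolding product_across_def by blast
    next
      case 2
      have "bond_op d N j (G' t j) *\<^sub>v ?w = phase t \<cdot>\<^sub>v tensor x y"
      proof -
        have "tensor x y \<in> carrier_vec (d ^ N)" using xy by (intro carrier_vecI) (simp add: N power_add)
        moreover have "bond_op d N h (G' t h) = phase t \<cdot>\<^sub>m 1\<^sub>m (d ^ N)"
          using h_pos h_less d_pos by (simp add: G'_def bond_op_smult_one)
        ultimately show ?thesis unfolding 2 xy(3) by (simp add: smult_mat_mult_vec[OF one_carrier_mat])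
      qed
      also have "\<dots> = tensor (phase t \<cdot>\<^sub>v x) y"
        by (rule tensor_eqI) (auto simp: index_tensor mult_add_less)
      finally show ?thesis using xy by (auto simp: product_across_def)
    qed
  qed
  finally show ?case .
qed

lemma product_across_evolution:
  assumes "product_across v"
  shows "product_across (evolution d (N, G') t *\<^sub>v v)"
proof (induction t)
  case 0
  obtain x y where "x \<in> carrier_vec (d ^ h)" "y \<in> carrier_vec (d ^ h)" "v = tensor x y"
    using assms by (auto simp: product_across_def)
  hence "v \<in> carrier_vec (d ^ N)" by (intro carrier_vecI) (simp add: N power_add)
  thus ?case using assms by simp
next
  case (Suc t)
  obtain x y where "x \<in> carrier_vec (d ^ h)" "y \<in> carrier_vec (d ^ h)" "v = tensor x y"
    using assms by (auto simp: product_across_def)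
  hence v: "v \<in> carrier_vec (d ^ N)" by (intro carrier_vecI) (simp add: N power_add)
  let ?E = "evolution d (N, G') t"
  have ev: "?E \<in> carrier_mat (d ^ N) (d ^ N)"
    by (intro unitary_mat_carrier unitary_evolution unitary_gate')
  have "evolution d (N, G') (Suc t) *\<^sub>v v =
      sublayer G' (Suc t) evens *\<^sub>v (sublayer G' (Suc t) odds *\<^sub>v (?E *\<^sub>v v))"
    using v ev sublayer_carrier[of G' "Suc t" evens] sublayer_carrier[of G' "Suc t" odds]
    by (simp add: layer_eq_sublayers assoc_mult_mat_vec[of _ "d ^ N" "d ^ N" _ "d ^ N"])
  thus ?case using Suc bonds by (auto intro!: product_across_sublayer)
qed

end

section \<open>Random product states\<close>

text \<open>Cauchy-Schwarz over the index of B bounds the overlap with the product vector by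
  \<open>vnorm y\<close> times the norm of \<open>T\<close>, the contraction of
  \<open>\<Psi>\<close> with \<open>x\<close>. The test vector for the reduced state is
  \<open>x\<close>, normalised.\<close>

lemma renyi_rho_A_le_overlap:
  assumes N: "N = h + h" and U: "unitary_mat (d ^ N) U" and \<psi>: "\<psi> \<in> carrier_vec (d ^ N)"
    and xy: "x \<in> carrier_vec (d ^ h)" "y \<in> carrier_vec (d ^ h)" "vnorm (tensor x y) = 1"
    and r: "0 < r" "r \<le> cmod (tensor x y \<bullet>c (U *\<^sub>v \<psi>))" and b: "1 < b" and \<alpha>: "1 < \<alpha>"
  shows "renyi b \<alpha> (trace_B d N (U * ket_bra \<psi> * mat_adjoint U)) \<le> \<alpha> / (\<alpha> - 1) * log b (1 / r\<^sup>2)"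
proof -
  let ?D = "d ^ h"
  define \<Psi> where "\<Psi> = U *\<^sub>v \<psi>"
  define T where "T z = (\<Sum>u<?D. \<Psi> $ (u * ?D + z) * cnj (x $ u))" for z
  have Uc: "U \<in> carrier_mat (d ^ N) (d ^ N)" using U by (rule unitary_mat_carrier)
  have h: "N div 2 = h" using N by simp
  have \<Psi>: "dim_vec \<Psi> = ?D * ?D" using Uc by (simp add: \<Psi>_def N power_add)
  have xn: "vnorm x * vnorm y = 1" using xy(3) by (simp add: vnorm_tensor)
  have "tensor x y \<bullet>c \<Psi> = (\<Sum>u<?D. \<Sum>w<?D. x $ u * y $ w * cnj (\<Psi> $ (u * ?D + w)))"
    using xy index_tensor[of _ x _ y] by (simp add: cscalar_prod_sum \<Psi> sum_lessThan_mult)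
  also have "\<dots> = (\<Sum>w<?D. \<Sum>u<?D. x $ u * y $ w * cnj (\<Psi> $ (u * ?D + w)))"
    by (rule sum.swap)
  also have "\<dots> = (\<Sum>w<?D. y $ w * cnj (T w))"
    unfolding T_def cnj_sum sum_distrib_left by (intro sum.cong refl) (simp add: mult_ac)
  finally have "cmod (tensor x y \<bullet>c \<Psi>) \<le> vnorm y * L2_set (\<lambda>w. cmod (T w)) {..<?D}"
    using cmod_sum_mult_le[of "\<lambda>w. y $ w" "\<lambda>w. cnj (T w)" "{..<?D}"] xy(2) by (simp add: vnorm_def)
  hence "r \<le> vnorm y * L2_set (\<lambda>w. cmod (T w)) {..<?D}" using r(2) by (simp add: \<Psi>_def)
  hence "r\<^sup>2 \<le> (vnorm y * L2_set (\<lambda>w. cmod (T w)) {..<?D})\<^sup>2" using r(1) by (intro power_mono) auto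
  also have "\<dots> = (vnorm y)\<^sup>2 * (\<Sum>z<?D. (cmod (T z))\<^sup>2)"
    by (simp add: power_mult_distrib L2_set_def sum_nonneg)
  finally have r2: "r\<^sup>2 \<le> (vnorm y)\<^sup>2 * (\<Sum>z<?D. (cmod (T z))\<^sup>2)" .
  \<comment> \<open>Only the product of the two norms is known to be 1, so \<open>x\<close> is
    rescaled and \<open>vnorm y\<close> plays the part of the factor
    \<open>1 / vnorm x\<close>.\<close>
  have xp: "vnorm x \<noteq> 0" using xn by auto
  hence y_eq: "vnorm y = 1 / vnorm x" using xn by (simp add: eq_divide_eq mult.commute)
  let ?u = "complex_of_real (1 / vnorm x) \<cdot>\<^sub>v x"
  have "cmod (\<Sum>u<?D. \<Psi> $ (u * ?D + z) * cnj (?u $ u)) = cmod (T z) * vnorm y" for z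
  proof -
    have "(\<Sum>u<?D. \<Psi> $ (u * ?D + z) * cnj (?u $ u)) = T z * complex_of_real (1 / vnorm x)"
      unfolding T_def sum_distrib_right using xy(1) by (intro sum.cong refl) auto
    thus ?thesis by (simp add: norm_mult y_eq norm_divide)
  qed
  hence e: "(\<Sum>z<?D. (cmod (\<Sum>u<?D. \<Psi> $ (u * ?D + z) * cnj (?u $ u)))\<^sup>2) =
      (vnorm y)\<^sup>2 * (\<Sum>z<?D. (cmod (T z))\<^sup>2)"
    by (simp add: power_mult_distrib sum_distrib_left mult_ac)
  show ?thesis
  proof (rule renyi_rho_A_le[OF _ Uc \<psi>, of ?u])
    show "vnorm ?u = 1" using xp by (simp add: vnorm_smult norm_divide)
    show "r\<^sup>2 \<le> (\<Sum>z<d ^ (N div 2). (cmod (\<Sum>u<d ^ (N div 2).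
        (U *\<^sub>v \<psi>) $ (u * d ^ (N div 2) + z) * cnj (?u $ u)))\<^sup>2)"
      unfolding h \<Psi>_def[symmetric] e by (rule r2)
  qed (use xy r N b \<alpha> h in auto)
qed

section \<open>Product states and the eigenbasis of the Pauli X operator\<close>

lemma product_state_carrier [simp]: "product_state d N v \<in> carrier_vec (d ^ N)"
  by (simp add: product_state_def)

lemma product_state_cscalar:
  assumes "\<And>i. i \<in> {1..N} \<Longrightarrow> w i \<in> carrier_vec d"
  shows "product_state d N v \<bullet>c product_state d N w = (\<Prod>i\<in>{1..N}. v i \<bullet>c w i)"
proof -
  have "product_state d N v \<bullet>c product_state d N w =
      (\<Sum>x<d ^ N. \<Prod>i\<in>{1..N}. v i $ digit d N x i * cnj (w i $ digit d N x i))"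
    by (simp add: cscalar_prod_sum product_state_def prod.distrib)
  also have "\<dots> = (\<Prod>i\<in>{1..N}. \<Sum>k<d. v i $ k * cnj (w i $ k))"
    by (rule sum_prod_digit)
  also have "\<dots> = (\<Prod>i\<in>{1..N}. v i \<bullet>c w i)"
  proof (rule prod.cong)
    fix i assume "i \<in> {1..N}"
    thus "(\<Sum>k<d. v i $ k * cnj (w i $ k)) = v i \<bullet>c w i"
      using assms[of i] by (simp add: cscalar_prod_sum)
  qed simp
  finally show ?thesis .
qed

lemma product_state_eq_tensor:
  "product_state d (m + n) v = tensor (product_state d m v) (product_state d n (\<lambda>i. v (m + i)))"
proof (rule tensor_eqI)
  fix u w assume "u < dim_vec (product_state d m v)" "w < dim_vec (product_state d n (\<lambda>i. v (m + i)))"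
  hence uw: "u < d ^ m" "w < d ^ n" by (simp_all add: product_state_def)
  have lt: "u * d ^ n + w < d ^ (m + n)" unfolding power_add using uw by (rule mult_add_less)
  have "(\<Prod>i\<in>{1..m + n}. v i $ digit d (m + n) (u * d ^ n + w) i) =
      (\<Prod>i\<in>{1..m}. v i $ digit d (m + n) (u * d ^ n + w) i) *
      (\<Prod>i\<in>{m + 1..m + n}. v i $ digit d (m + n) (u * d ^ n + w) i)"
    by (rule prod.ub_add_nat) simp
  also have "(\<Prod>i\<in>{m + 1..m + n}. v i $ digit d (m + n) (u * d ^ n + w) i) =
      (\<Prod>i\<in>{1..n}. v (m + i) $ digit d (m + n) (u * d ^ n + w) (m + i))"
    using prod.shift_bounds_cl_nat_ivl[of "\<lambda>i. v i $ digit d (m + n) (u * d ^ n + w) i" 1 m n]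
    by (simp add: add.commute)
  also have "\<dots> = (\<Prod>i\<in>{1..n}. v (m + i) $ digit d n w i)"
    using uw by (intro prod.cong refl) (simp add: digit_lower)
  also have "(\<Prod>i\<in>{1..m}. v i $ digit d (m + n) (u * d ^ n + w) i) = (\<Prod>i\<in>{1..m}. v i $ digit d m u i)"
    using uw by (intro prod.cong refl) (simp add: digit_upper)
  finally show "product_state d (m + n) v $ (u * dim_vec (product_state d n (\<lambda>i. v (m + i))) + w) =
      product_state d m v $ u * product_state d n (\<lambda>i. v (m + i)) $ w"
    using uw lt by (simp add: product_state_def)
qed (simp add: product_state_def power_add)

lemma unit_vec_cscalar_self: "0 < d \<Longrightarrow> unit_vec d 0 \<bullet>c unit_vec d 0 = (1 :: complex)"
proof -
  assume "0 < d"
  have "unit_vec d 0 \<bullet>c unit_vec d 0 = (\<Sum>i<d. if i = 0 then 1 else (0 :: complex))"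
    unfolding cscalar_prod_sum by (intro sum.cong) auto
  thus ?thesis using \<open>0 < d\<close> by simp
qed

text \<open>The eigenvalue equation relates cyclically adjacent components by the factor
  \<open>\<mu>\<close>. Once around the cycle \<open>\<mu> ^ d = 1\<close>, so all \<open>d\<close>
  components have equal modulus.\<close>

lemma X_eigenvector_cmod:
  assumes v: "v \<in> carrier_vec d" "v \<bullet>c v = 1" and ev: "pauli_X d *\<^sub>v v = \<mu> \<cdot>\<^sub>v v" and d: "0 < d"
  shows "(cmod (v $ 0))\<^sup>2 = 1 / real d"
proof -
  have shift: "v $ l = \<mu> * v $ (Suc l mod d)" if l: "l < d" for l
  proof -
    have inj: "Suc l mod d = Suc l' mod d \<longleftrightarrow> l' = l" if "l' < d" for l'
      using l that by (auto simp: mod_Suc)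
    have "(pauli_X d *\<^sub>v v) $ (Suc l mod d) =
        (\<Sum>l'<d. (if Suc l mod d = Suc l' mod d then 1 else 0) * v $ l')"
      using v d by (subst index_mult_mat_vec_sum) (auto simp: pauli_X_def)
    also have "\<dots> = (\<Sum>l'<d. if l' = l then v $ l else 0)"
      using inj by (intro sum.cong refl) auto
    also have "\<dots> = v $ l" using l by simp
    finally show ?thesis using ev v d by simp
  qed
  have pow: "v $ 0 = \<mu> ^ l * v $ l" if "l < d" for l
    using that
  proof (induction l)
    case (Suc l)
    thus ?case using shift[of l] by simp
  qed simp
  have nz: "(\<Sum>l<d. (cmod (v $ l))\<^sup>2) = 1"
  proof -
    have "complex_of_real ((vnorm v)\<^sup>2) = complex_of_real 1"
      using v(2) unfolding cscalar_prod_self by simp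
    hence "(vnorm v)\<^sup>2 = 1" by (simp only: of_real_eq_iff)
    thus ?thesis using v(1) by (simp add: vnorm_power2)
  qed
  \<comment> \<open>If component 0 vanished, all would: by \<open>pow\<close> for nonzero
    \<open>\<mu>\<close>, by \<open>shift\<close> for \<open>\<mu> = 0\<close>.\<close>
  have v0: "v $ 0 \<noteq> 0"
  proof
    assume z: "v $ 0 = 0"
    have "v $ l = 0" if l: "l < d" for l
      using pow[OF l] shift[OF l] z by (cases "\<mu> = 0") auto
    hence "(\<Sum>l<d. (cmod (v $ l))\<^sup>2) = 0" by simp
    thus False using nz by simp
  qed
  have "v $ 0 = \<mu> ^ (d - 1) * v $ (d - 1)" using pow[of "d - 1"] d by simp
  also have "v $ (d - 1) = \<mu> * v $ 0" using shift[of "d - 1"] d by simp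
  finally have "v $ 0 = \<mu> ^ d * v $ 0" using d by (cases d) (auto simp: mult_ac)
  hence "\<mu> ^ d = 1" using v0 by simp
  hence "cmod \<mu> ^ d = 1" by (metis norm_one norm_power)
  hence \<mu>: "cmod \<mu> = 1" using d power_eq_imp_eq_base[of "cmod \<mu>" d 1] by simp
  have "(\<Sum>l<d. (cmod (v $ l))\<^sup>2) = (\<Sum>l<d. (cmod (v $ 0))\<^sup>2)"
  proof (rule sum.cong)
    fix l assume "l \<in> {..<d}"
    hence "v $ 0 = \<mu> ^ l * v $ l" using pow by simp
    thus "(cmod (v $ l))\<^sup>2 = (cmod (v $ 0))\<^sup>2" using \<mu> by (simp add: norm_mult norm_power)
  qed simp
  hence "(\<Sum>l<d. (cmod (v $ l))\<^sup>2) = real d * (cmod (v $ 0))\<^sup>2" by simp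
  thus ?thesis using nz d by (simp add: field_simps)
qed

lemma X_eigenbasisD:
  assumes "X_eigenbasis d e" "0 < d"
  shows "k < d \<Longrightarrow> e k \<in> carrier_vec d"
    and "k < d \<Longrightarrow> l < d \<Longrightarrow> e k \<bullet>c e l = (if k = l then 1 else 0)"
    and "k < d \<Longrightarrow> (cmod (unit_vec d 0 \<bullet>c e k))\<^sup>2 = 1 / real d"
proof -
  have c: "e k \<in> carrier_vec d" if "k < d" for k
    using assms(1) that by (force simp: X_eigenbasis_def eigenvector_def pauli_X_def)
  have o: "e k \<bullet>c e l = (if k = l then 1 else 0)" if "k < d" "l < d" for k l
    using assms(1) that by (simp add: X_eigenbasis_def)
  show "k < d \<Longrightarrow> e k \<in> carrier_vec d" by (rule c)
  show "k < d \<Longrightarrow> l < d \<Longrightarrow> e k \<bullet>c e l = (if k = l then 1 else 0)" by (rule o)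
  assume k: "k < d"
  obtain \<mu> where "eigenvector (pauli_X d) (e k) \<mu>" using assms(1) k by (auto simp: X_eigenbasis_def)
  hence "pauli_X d *\<^sub>v e k = \<mu> \<cdot>\<^sub>v e k" by (simp add: eigenvector_def)
  hence "(cmod (e k $ 0))\<^sup>2 = 1 / real d"
    using X_eigenvector_cmod[OF c[OF k]] o[OF k k] assms(2) by simp
  moreover have "unit_vec d 0 \<bullet>c e k = (\<Sum>i<d. if i = 0 then cnj (e k $ 0) else 0)"
    unfolding cscalar_prod_sum using c[OF k] by (intro sum.cong) auto
  ultimately show "(cmod (unit_vec d 0 \<bullet>c e k))\<^sup>2 = 1 / real d" using assms(2) by simp
qed

text \<open>Second moment method: for fixed labels outside \<open>C\<close> the vectors \<open>f s\<close> are orthonormal, so by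
  Bessel a vector that ignores the labels in \<open>C\<close> has mean squared overlap at most
  \<open>\<delta>\<^sup>2 / d ^ card C\<close> with them.\<close>

lemma card_large_overlap_le:
  fixes d N :: nat and f \<eta> :: "(nat \<Rightarrow> nat) \<Rightarrow> complex vec"
  defines "S \<equiv> PiE_dflt {1..N} 0 (\<lambda>_. {..<d})"
  assumes d: "0 < d" and C: "C \<subseteq> {1..N}"
    and f: "\<And>s. s \<in> S \<Longrightarrow> f s \<in> carrier_vec n"
    and orth: "\<And>s s'. s \<in> S \<Longrightarrow> s' \<in> S \<Longrightarrow> f s \<bullet>c f s' = (if s = s' then 1 else 0)"
    and \<eta>: "\<And>s. s \<in> S \<Longrightarrow> \<eta> s \<in> carrier_vec n" "\<And>s. s \<in> S \<Longrightarrow> vnorm (\<eta> s) \<le> \<delta>"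
    and loc: "\<And>s. s \<in> S \<Longrightarrow> \<eta> s = \<eta> (\<lambda>j. if j \<in> C then 0 else s j)"
  shows "real (card {s \<in> S. 1 / (4 * real d ^ card C) < (cmod (\<eta> s \<bullet>c f s))\<^sup>2}) \<le> 4 * \<delta>\<^sup>2 * real d ^ N"
proof -
  define m where "m = card C"
  \<comment> \<open>Resetting the labels in \<open>C\<close> to 0 selects a representative in
    \<open>T\<close> of each class of labels that agree outside \<open>C\<close>; there are
    \<open>d ^ (N - m)\<close> classes.\<close>
  define g where "g s = (\<lambda>j. if j \<in> C then 0 else s j)" for s :: "nat \<Rightarrow> nat"
  define T where "T = PiE_dflt ({1..N} - C) 0 (\<lambda>_. {..<d})"
  define X where "X s = (cmod (\<eta> s \<bullet>c f s))\<^sup>2" for s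
  let ?bad = "{s \<in> S. 1 / (4 * real d ^ m) < X s}"
  have finS: "finite S" and finT: "finite T"
    unfolding S_def T_def by (auto intro!: finite_PiE_dflt)
  have mN: "m \<le> N" using card_mono[OF _ C] by (simp add: m_def)
  have gT: "g ` S \<subseteq> T" and TS: "T \<subseteq> S"
    using d by (auto simp: S_def T_def g_def PiE_dflt_def)
  have cardT: "card T = d ^ (N - m)"
    unfolding T_def m_def using C by (subst card_PiE_dflt) (auto simp: card_Diff_subset finite_subset)
  have "sum X S = (\<Sum>y\<in>T. \<Sum>s\<in>{s \<in> S. g s = y}. X s)"
    by (rule sum.group[OF finS finT gT, symmetric])
  also have "\<dots> \<le> (\<Sum>y\<in>T. \<delta>\<^sup>2)"
  proof (rule sum_mono)
    fix y assume "y \<in> T"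
    hence y: "y \<in> S" using TS by auto
    have "(\<Sum>s\<in>{s \<in> S. g s = y}. X s) = (\<Sum>s\<in>{s \<in> S. g s = y}. (cmod (\<eta> y \<bullet>c f s))\<^sup>2)"
      using loc by (intro sum.cong refl) (auto simp: X_def g_def)
    also have "\<dots> \<le> (vnorm (\<eta> y))\<^sup>2"
      using finS f orth \<eta>(1)[OF y] by (intro bessel_inequality) auto
    also have "\<dots> \<le> \<delta>\<^sup>2" using \<eta>(2)[OF y] by (intro power_mono) auto
    finally show "(\<Sum>s\<in>{s \<in> S. g s = y}. X s) \<le> \<delta>\<^sup>2" .
  qed
  also have "\<dots> = real d ^ (N - m) * \<delta>\<^sup>2" by (simp add: cardT)
  finally have sum: "sum X S \<le> real d ^ (N - m) * \<delta>\<^sup>2" .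
  \<comment> \<open>Markov's inequality in counting form: each bad label adds more than the
    threshold to the sum.\<close>
  have "real (card ?bad) * (1 / (4 * real d ^ m)) = (\<Sum>s\<in>?bad. 1 / (4 * real d ^ m))" by simp
  also have "\<dots> \<le> sum X ?bad" by (intro sum_mono) auto
  also have "\<dots> \<le> sum X S" using finS by (intro sum_mono2) (auto simp: X_def)
  finally have "real (card ?bad) * (1 / (4 * real d ^ m)) \<le> real d ^ (N - m) * \<delta>\<^sup>2" using sum by simp
  hence "real (card ?bad) \<le> 4 * \<delta>\<^sup>2 * (real d ^ (N - m) * real d ^ m)"
    using d by (simp add: field_simps)
  also have "real d ^ (N - m) * real d ^ m = real d ^ N" using mN by (simp add: power_add[symmetric])
  finally show ?thesis by (simp add: X_def m_def)
qed

section \<open>The entropy bound for most initial states\<close>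

context cut_chain
begin

text \<open>With \<open>\<epsilon>\<close> bounding the defect at the cut up to time
  \<open>t\<close>, the decoupled evolution is off by at most
  \<open>\<delta> = 2 * t * \<epsilon>\<close>; the exceptional probability is
  \<open>4 * \<delta>\<^sup>2\<close>.\<close>

lemma prob_renyi_ge:
  fixes e :: "nat \<Rightarrow> complex vec" and C :: "nat set"
  defines "\<theta> \<equiv> \<lambda>s. product_state d N (\<lambda>j. if j \<in> C then unit_vec d 0 else e (s j))"
  assumes e: "X_eigenbasis d e" and C: "C \<subseteq> {1..N}" and \<epsilon>: "0 \<le> \<epsilon>" and b: "1 < b" and \<alpha>: "1 < \<alpha>"
    and small: "\<And>s \<tau>. (\<And>j. s j < d) \<Longrightarrow> \<tau> \<le> t \<Longrightarrow>
      vnorm (evolution d (N, G) \<tau> *\<^sub>v \<theta> s - P *\<^sub>v (evolution d (N, G) \<tau> *\<^sub>v \<theta> s)) \<le> \<epsilon>"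
  shows "1 - 16 * (real t)\<^sup>2 * \<epsilon>\<^sup>2 \<le> measure_pmf.prob (random_X_state d N e)
    {\<psi>. renyi b \<alpha> (rho_A d (N, G) t \<psi>) \<le> \<alpha> / (\<alpha> - 1) * log b (4 * real d ^ card C)}"
proof -
  define S where "S = PiE_dflt {1..N} (0::nat) (\<lambda>_. {..<d})"
  define \<psi> where "\<psi> s = product_state d N (\<lambda>i. e (s i))" for s
  define \<delta> where "\<delta> = 2 * real t * \<epsilon>"
  define m where "m = card C"
  let ?U = "evolution d (N, G) t" and ?U' = "evolution d (N, G') t"
  define \<eta> where "\<eta> s = ?U' *\<^sub>v \<theta> s - ?U *\<^sub>v \<theta> s" for s
  note eD = X_eigenbasisD[OF e d_pos]
  \<comment> \<open>Labels outside the chain have the default value 0, so the bound holds at every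
    \<open>j\<close>, as \<open>small\<close> demands.\<close>
  have Sd: "s j < d" if "s \<in> S" for s j
    using that d_pos by (cases "j \<in> {1..N}") (auto simp: S_def PiE_dflt_def)
  have U: "unitary_mat (d ^ N) ?U" and U': "unitary_mat (d ^ N) ?U'"
    by (intro unitary_evolution unitary_gate; assumption) (intro unitary_evolution unitary_gate'; assumption)
  have Uc: "?U \<in> carrier_mat (d ^ N) (d ^ N)" "?U' \<in> carrier_mat (d ^ N) (d ^ N)"
    using U U' by (auto simp: unitary_mat_def)
  have c: "\<psi> s \<in> carrier_vec (d ^ N)" "\<theta> s \<in> carrier_vec (d ^ N)" for s
    by (simp_all add: \<psi>_def \<theta>_def)
  have \<eta>c: "\<eta> s \<in> carrier_vec (d ^ N)" for s using Uc c by (simp add: \<eta>_def)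
  have orth: "\<psi> s \<bullet>c \<psi> s' = (if s = s' then 1 else 0)" if s: "s \<in> S" "s' \<in> S" for s s'
  proof -
    have "\<psi> s \<bullet>c \<psi> s' = (\<Prod>i\<in>{1..N}. if s i = s' i then 1 else 0)"
      unfolding \<psi>_def using s by (subst product_state_cscalar) (auto simp: eD Sd)
    also have "\<dots> = (if s = s' then 1 else 0)"
    proof (cases "s = s'")
      case False
      then obtain i where "s i \<noteq> s' i" by auto
      moreover have "i \<in> {1..N}"
        by (rule ccontr) (use s calculation in \<open>auto simp: S_def PiE_dflt_def\<close>)
      ultimately show ?thesis using False by (auto intro!: prod_zero)
    qed simp
    finally show ?thesis .
  qed
  have \<theta>n: "vnorm (\<theta> s) = 1" if s: "s \<in> S" for s
  proof -
    have "\<theta> s \<bullet>c \<theta> s = (\<Prod>i\<in>{1..N}. 1)"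
      unfolding \<theta>_def using s d_pos
      by (subst product_state_cscalar) (auto simp: eD Sd unit_vec_cscalar_self intro!: prod.cong)
    hence "complex_of_real ((vnorm (\<theta> s))\<^sup>2) = complex_of_real 1" unfolding cscalar_prod_self by simp
    hence "(vnorm (\<theta> s))\<^sup>2 = 1" by (simp only: of_real_eq_iff)
    thus ?thesis using vnorm_nonneg[of "\<theta> s"] by (simp add: power2_eq_1_iff)
  qed
  have overlap: "(cmod (\<theta> s \<bullet>c \<psi> s))\<^sup>2 = 1 / real d ^ m" if s: "s \<in> S" for s
  proof -
    have "\<theta> s \<bullet>c \<psi> s = (\<Prod>i\<in>{1..N}. if i \<in> C then unit_vec d 0 \<bullet>c e (s i) else 1)"
      unfolding \<theta>_def \<psi>_def using s
      by (subst product_state_cscalar) (auto simp: eD Sd intro!: prod.cong)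
    also have "\<dots> = (\<Prod>i\<in>C. unit_vec d 0 \<bullet>c e (s i))"
      by (rule prod.mono_neutral_cong_right) (use C in auto)
    finally have "(cmod (\<theta> s \<bullet>c \<psi> s))\<^sup>2 = (\<Prod>i\<in>C. (cmod (unit_vec d 0 \<bullet>c e (s i)))\<^sup>2)"
      by (simp add: prod_norm[symmetric] prod_power_distrib)
    also have "\<dots> = (\<Prod>i\<in>C. 1 / real d)" using s by (intro prod.cong refl) (simp add: eD Sd)
    finally show ?thesis by (simp add: m_def power_one_over)
  qed
  \<comment> \<open>The threshold is a quarter of the squared overlap \<open>r\<^sup>2\<close>: a
    smaller error leaves an overlap of at least \<open>r / 2\<close> with the product vector, and
    \<open>1 / (r / 2)\<^sup>2\<close> is \<open>4 * d ^ m\<close>.\<close>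
  have good: "renyi b \<alpha> (rho_A d (N, G) t (\<psi> s)) \<le> \<alpha> / (\<alpha> - 1) * log b (4 * real d ^ m)"
    if s: "s \<in> S" and close: "(cmod (\<eta> s \<bullet>c (?U *\<^sub>v \<psi> s)))\<^sup>2 \<le> 1 / (4 * real d ^ m)" for s
  proof -
    have "product_across (\<theta> s)"
      unfolding product_across_def \<theta>_def N product_state_eq_tensor using product_state_carrier by blast
    then obtain x y where xy: "x \<in> carrier_vec (d ^ h)" "y \<in> carrier_vec (d ^ h)" "?U' *\<^sub>v \<theta> s = tensor x y"
      using product_across_evolution[of "\<theta> s" t] by (auto simp: product_across_def)
    define r where "r = sqrt (1 / real d ^ m)"
    have r: "0 < r" "r\<^sup>2 = 1 / real d ^ m" using d_pos by (auto simp: r_def)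
    have "(cmod (\<eta> s \<bullet>c (?U *\<^sub>v \<psi> s)))\<^sup>2 \<le> (r / 2)\<^sup>2" using close by (simp add: power_divide r(2))
    hence small: "cmod (\<eta> s \<bullet>c (?U *\<^sub>v \<psi> s)) \<le> r / 2" using r(1) by (simp add: power2_le_iff_abs_le)
    have "cmod ((?U *\<^sub>v \<theta> s) \<bullet>c (?U *\<^sub>v \<psi> s)) = r"
      unfolding unitary_cscalar[OF U c(2) c(1)] using overlap[OF s] by (simp add: r_def real_sqrt_unique)
    moreover have "(?U *\<^sub>v \<theta> s) \<bullet>c (?U *\<^sub>v \<psi> s) =
        (?U' *\<^sub>v \<theta> s) \<bullet>c (?U *\<^sub>v \<psi> s) - \<eta> s \<bullet>c (?U *\<^sub>v \<psi> s)"
      using Uc c[of s] unfolding \<eta>_def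
      by (subst minus_scalar_prod_distrib[of _ "d ^ N"]) (auto intro: mult_mat_vec_carrier)
    ultimately have "r \<le> cmod ((?U' *\<^sub>v \<theta> s) \<bullet>c (?U *\<^sub>v \<psi> s)) + cmod (\<eta> s \<bullet>c (?U *\<^sub>v \<psi> s))"
      by (metis norm_triangle_ineq4)
    hence "r / 2 \<le> cmod (tensor x y \<bullet>c (?U *\<^sub>v \<psi> s))" using small unfolding xy(3) by simp
    moreover have "vnorm (tensor x y) = 1"
      unfolding xy(3)[symmetric] unitary_vnorm[OF U' c(2)] by (rule \<theta>n[OF s])
    ultimately have "renyi b \<alpha> (rho_A d (N, G) t (\<psi> s)) \<le> \<alpha> / (\<alpha> - 1) * log b (1 / (r / 2)\<^sup>2)"
      unfolding rho_A_def fst_conv using r(1) xy b \<alpha>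
      by (intro renyi_rho_A_le_overlap[OF N U c(1) xy(1,2)]) auto
    thus ?thesis by (simp add: power_divide r(2) mult.commute)
  qed
  let ?bad = "{s \<in> S. 1 / (4 * real d ^ m) < (cmod (\<eta> s \<bullet>c (?U *\<^sub>v \<psi> s)))\<^sup>2}"
  have bad: "real (card ?bad) \<le> 4 * \<delta>\<^sup>2 * real d ^ N"
    unfolding S_def m_def
  proof (rule card_large_overlap_le[OF d_pos C, of _ "d ^ N"]; (fold S_def)?)
    fix s s' assume s: "s \<in> S"
    show "?U *\<^sub>v \<psi> s \<in> carrier_vec (d ^ N)" using Uc c by (auto intro: mult_mat_vec_carrier)
    show "\<eta> s \<in> carrier_vec (d ^ N)" by (rule \<eta>c)
    have "vnorm (?U *\<^sub>v \<theta> s - ?U' *\<^sub>v \<theta> s) \<le> \<delta>"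
      unfolding \<delta>_def using Sd[OF s] small by (intro evolution_diff_le c) auto
    moreover have "\<eta> s = (- 1) \<cdot>\<^sub>v (?U *\<^sub>v \<theta> s - ?U' *\<^sub>v \<theta> s)"
      using Uc c[of s] by (intro eq_vecI) (auto simp: \<eta>_def)
    ultimately show "vnorm (\<eta> s) \<le> \<delta>" by (simp add: vnorm_smult)
    \<comment> \<open>The state \<open>\<theta> s\<close> ignores the labels in \<open>C\<close>,
      and so does the error vector \<open>\<eta> s\<close>.\<close>
    have "(\<lambda>j. if j \<in> C then unit_vec d 0 else e (s j)) =
        (\<lambda>j. if j \<in> C then unit_vec d 0 else e ((\<lambda>j. if j \<in> C then 0 else s j) j))" by auto
    hence "\<theta> s = \<theta> (\<lambda>j. if j \<in> C then 0 else s j)" unfolding \<theta>_def by (simp only:)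
    thus "\<eta> s = \<eta> (\<lambda>j. if j \<in> C then 0 else s j)" by (simp only: \<eta>_def)
    assume "s' \<in> S"
    thus "(?U *\<^sub>v \<psi> s) \<bullet>c (?U *\<^sub>v \<psi> s') = (if s = s' then 1 else 0)"
      using orth[OF s] unitary_cscalar[OF U c(1) c(1)] by simp
  qed
  let ?E = "{\<psi>. renyi b \<alpha> (rho_A d (N, G) t \<psi>) \<le> \<alpha> / (\<alpha> - 1) * log b (4 * real d ^ card C)}"
  have finS: "finite S" unfolding S_def by (auto intro!: finite_PiE_dflt)
  have cardS: "card S = d ^ N" unfolding S_def by (subst card_PiE_dflt) auto
  have Sne: "S \<noteq> {}" using cardS d_pos by auto
  \<comment> \<open>Independent uniform labels are jointly uniform on the finite set
    \<open>S\<close>, so probabilities become counts.\<close>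
  have pmf: "random_X_state d N e = map_pmf \<psi> (pmf_of_set S)"
    unfolding random_X_state_def S_def \<psi>_def[abs_def] using d_pos
    by (subst Pi_pmf_of_set) auto
  have "1 - 16 * (real t)\<^sup>2 * \<epsilon>\<^sup>2 = 1 - 4 * \<delta>\<^sup>2" by (simp add: \<delta>_def power_mult_distrib)
  also have "\<dots> = (real d ^ N - 4 * \<delta>\<^sup>2 * real d ^ N) / real d ^ N" using d_pos by (simp add: field_simps)
  also have "\<dots> \<le> (real d ^ N - real (card ?bad)) / real d ^ N"
    using bad by (intro divide_right_mono) auto
  also have "real d ^ N - real (card ?bad) = real (card (S - ?bad))"
    using finS card_mono[OF finS, of ?bad] by (subst card_Diff_subset) (auto simp: cardS of_nat_diff)
  also have "\<dots> / real d ^ N \<le> real (card (S \<inter> \<psi> -` ?E)) / real d ^ N"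
  proof (intro divide_right_mono of_nat_mono card_mono subsetI)
    fix s assume "s \<in> S - ?bad"
    hence "s \<in> S" "(cmod (\<eta> s \<bullet>c (?U *\<^sub>v \<psi> s)))\<^sup>2 \<le> 1 / (4 * real d ^ m)" by (auto simp: not_less)
    thus "s \<in> S \<inter> \<psi> -` ?E" using good by (simp add: m_def)
  qed (use finS in auto)
  also have "\<dots> = measure_pmf.prob (random_X_state d N e) ?E"
    unfolding pmf measure_map_pmf using measure_pmf_of_set[OF Sne finS] by (simp add: cardS)
  finally show ?thesis .
qed


text \<open>\<open>C\<close> consists of the \<open>k\<close> sites on either side of the cut.
  Diffusive transport bounds the charge at the two central sites, and the charge bounds the
  defect.\<close>

lemma cut_proj_evolution_small:
  fixes e :: "nat \<Rightarrow> complex vec" and k t :: nat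
  defines "C \<equiv> {h + 1 - k..<h + 1 - k + 2 * k}"
  defines "\<theta> \<equiv> \<lambda>s. product_state d N (\<lambda>j. if j \<in> C then unit_vec d 0 else e (s j))"
  assumes diffusive: "no_faster_than_diffusive d F c x0" and F: "(N, G) \<in> F"
    and e: "X_eigenbasis d e" and k: "2 \<le> k" "k \<le> h"
    and large: "x0 (1/4) < (real (2 * k))\<^sup>2 / real t" and s: "\<And>j. s j < d" and \<tau>: "\<tau> \<le> t"
  shows "vnorm (evolution d (N, G) \<tau> *\<^sub>v \<theta> s - P *\<^sub>v (evolution d (N, G) \<tau> *\<^sub>v \<theta> s))
    \<le> sqrt (2 * exp (- c (1/4) * (real (2 * k))\<^sup>2 / real t))"
proof (cases "\<tau> = 0")
  \<comment> \<open>The transport condition starts at time 1. At time 0 there is no defect, as both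
    sites at the cut lie in \<open>C\<close>.\<close>
  case True
  have c: "\<theta> s \<in> carrier_vec (d ^ N)" by (simp add: \<theta>_def)
  have hC: "h \<in> C" "h + 1 \<in> C" using k by (auto simp: C_def)
  have "P *\<^sub>v \<theta> s = \<theta> s"
  proof (rule eq_vecI)
    fix x assume "x < dim_vec (\<theta> s)"
    hence x: "x < d ^ N" using c by simp
    have "\<theta> s $ x = 0" if i: "i \<in> {h, h + 1}" "digit d N x i \<noteq> 0" for i
    proof -
      have "i \<in> {1..N}" "i \<in> C" using i hC h_pos h_less by auto
      moreover have "unit_vec d 0 $ digit d N x i = (0::complex)"
        using i(2) digit_less[OF d_pos] d_pos by simp
      ultimately show ?thesis using x by (auto simp: \<theta>_def product_state_def intro!: bexI[of _ i])
    qed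
    thus "(P *\<^sub>v \<theta> s) $ x = \<theta> s $ x"
      unfolding cut_proj_def mat_diag_mult_vec[OF c] using x by auto
  qed (simp add: cut_proj_def mat_diag_def \<theta>_def product_state_def)
  moreover have "evolution d (N, G) \<tau> *\<^sub>v \<theta> s = \<theta> s" using True c by simp
  moreover have "\<theta> s - \<theta> s = 0\<^sub>v (d ^ N)" using c by auto
  ultimately show ?thesis by simp
next
  case False
  define w where "w = evolution d (N, G) \<tau> *\<^sub>v \<theta> s"
  let ?m = "2 * k" and ?a = "h + 1 - k"
  note eD = X_eigenbasisD[OF e d_pos]
  \<comment> \<open>Sites \<open>h\<close> and \<open>h + 1\<close> have distance at least
    \<open>k - 1\<close> from the ends of \<open>C\<close>, which is at least a quarter of
    \<open>2 * k\<close> because \<open>2 \<le> k\<close>.\<close>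
  have "0 < (1/4::real) \<and> (1/4::real) < 1/2" by simp
  note D = mp[OF spec[OF diffusive[unfolded no_faster_than_diffusive_def], of "1/4"] this]
  note DF = bspec[OF conjunct2[OF conjunct2[OF D]] F, unfolded prod.case]
  have c: "0 < c (1/4)" by (rule conjunct1[OF D])
  have ev: "evolution d (N, G) \<tau> \<in> carrier_mat (d ^ N) (d ^ N)"
    by (intro unitary_mat_carrier unitary_evolution unitary_gate; assumption)
  have w: "w \<in> carrier_vec (d ^ N)" unfolding w_def \<theta>_def using ev by (rule mult_mat_vec_carrier) simp
  \<comment> \<open>Earlier times are easier: the threshold still holds and the exponential bound is
    stronger than at time \<open>t\<close>.\<close>
  have mono: "(real ?m)\<^sup>2 / real t \<le> (real ?m)\<^sup>2 / real \<tau>"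
    using False \<tau> by (intro divide_left_mono) auto
  have bound: "expect (charge d N i) w \<le> exp (- c (1/4) * (real ?m)\<^sup>2 / real t)" if i: "i \<in> {h, h + 1}" for i
  proof -
    let ?v = "\<lambda>j. if j \<in> C then unit_vec d 0 else e (s j)"
    have "expect (charge d N i) w \<le> exp (- c (1/4) * (real ?m)\<^sup>2 / real \<tau>)"
      unfolding w_def \<theta>_def
    proof (rule DF[THEN spec[of _ ?a], THEN spec[of _ ?m], THEN spec[of _ i], THEN spec[of _ ?v],
          THEN spec[of _ \<tau>], THEN mp], intro conjI)
      show "1/4 * real ?m \<le> real i - real ?a" "1/4 * real ?m \<le> real (?a + ?m - 1) - real i"
        using i k by (auto simp: of_nat_diff)
      show "?a + ?m \<le> N + 1" using k N by linarith
      show "x0 (1/4) < (real ?m)\<^sup>2 / real \<tau>" using large mono by linarith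
      show "\<forall>j\<in>{1..N}. ?v j \<in> carrier_vec d \<and> ?v j \<bullet>c ?v j = 1"
        using eD s unit_vec_cscalar_self[OF d_pos] by auto
    qed (use i k False in \<open>auto simp: C_def\<close>)
    also have "\<dots> \<le> exp (- c (1/4) * (real ?m)\<^sup>2 / real t)"
      using mult_left_mono[OF mono, of "c (1/4)"] c by simp
    finally show ?thesis .
  qed
  have "(vnorm (w - P *\<^sub>v w))\<^sup>2 \<le> expect (charge d N h) w + expect (charge d N (h + 1)) w"
    by (rule vnorm_cut_proj_le_charge[OF d_pos h_pos h_less w])
  also have "\<dots> \<le> 2 * exp (- c (1/4) * (real ?m)\<^sup>2 / real t)" using bound[of h] bound[of "h + 1"] by simp
  finally show ?thesis unfolding w_def by (rule real_le_rsqrt)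
qed

lemma prob_renyi_diffusive:
  assumes diffusive: "no_faster_than_diffusive d F c x0" "(N, G) \<in> F" and e: "X_eigenbasis d e"
    and k: "2 \<le> k" "k \<le> h" and large: "x0 (1/4) < (real (2 * k))\<^sup>2 / real t"
    and b: "1 < b" and \<alpha>: "1 < \<alpha>"
  shows "1 - 32 * (real t)\<^sup>2 * exp (- c (1/4) * (real (2 * k))\<^sup>2 / real t) \<le>
    measure_pmf.prob (random_X_state d N e)
      {\<psi>. renyi b \<alpha> (rho_A d (N, G) t \<psi>) \<le> \<alpha> / (\<alpha> - 1) * log b (4 * real d ^ (2 * k))}"
proof -
  let ?C = "{h + 1 - k..<h + 1 - k + 2 * k}"
  have C: "?C \<subseteq> {1..N}" using k N by auto
  let ?\<epsilon> = "sqrt (2 * exp (- c (1/4) * (real (2 * k))\<^sup>2 / real t))"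
  have "1 - 16 * (real t)\<^sup>2 * ?\<epsilon>\<^sup>2 \<le> measure_pmf.prob (random_X_state d N e)
      {\<psi>. renyi b \<alpha> (rho_A d (N, G) t \<psi>) \<le> \<alpha> / (\<alpha> - 1) * log b (4 * real d ^ card ?C)}"
    by (rule prob_renyi_ge[OF e C _ b \<alpha> cut_proj_evolution_small[OF diffusive e k large]]) simp_all
  thus ?thesis by simp
qed

text \<open>The bound for chains too short to contain \<open>C\<close>. The squared weights of the
  evolved state over the basis of A sum to 1, so one of the \<open>d ^ h\<close> basis vectors has
  weight at least \<open>1 / d ^ h\<close> and serves as the test vector.\<close>

lemma prob_renyi_dimension:
  assumes e: "X_eigenbasis d e" and b: "1 < b" and \<alpha>: "1 < \<alpha>"
  shows "measure_pmf.prob (random_X_state d N e)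
    {\<psi>. renyi b \<alpha> (rho_A d (N, G) t \<psi>) \<le> \<alpha> / (\<alpha> - 1) * log b (real d ^ h)} = 1"
  unfolding measure_pmf.prob_eq_1[OF sets_measure_pmf[THEN equalityD2, THEN subsetD, OF UNIV_I]] AE_measure_pmf_iff
proof (intro ballI)
  fix \<psi> assume "\<psi> \<in> set_pmf (random_X_state d N e)"
  then obtain s where s: "s \<in> set_pmf (Pi_pmf {1..N} 0 (\<lambda>_. pmf_of_set {..<d}))"
    and \<psi>: "\<psi> = product_state d N (\<lambda>i. e (s i))" by (auto simp: random_X_state_def)
  have sd: "s i < d" if "i \<in> {1..N}" for i
    using s that d_pos by (auto simp: set_Pi_pmf PiE_dflt_def lessThan_empty_iff)
  note eD = X_eigenbasisD[OF e d_pos]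
  let ?U = "evolution d (N, G) t" and ?D = "d ^ h"
  define \<Psi> where "\<Psi> = ?U *\<^sub>v \<psi>"
  have U: "unitary_mat (d ^ N) ?U" by (intro unitary_evolution unitary_gate; assumption)
  have Uc: "?U \<in> carrier_mat (d ^ N) (d ^ N)" using U by (rule unitary_mat_carrier)
  have \<psi>c: "\<psi> \<in> carrier_vec (d ^ N)" by (simp add: \<psi>)
  have "\<psi> \<bullet>c \<psi> = (\<Prod>i\<in>{1..N}. 1)"
    unfolding \<psi> by (subst product_state_cscalar) (auto simp: eD sd intro!: prod.cong)
  hence "complex_of_real ((vnorm \<psi>)\<^sup>2) = complex_of_real 1" unfolding cscalar_prod_self by simp
  hence "(vnorm \<psi>)\<^sup>2 = 1" by (simp only: of_real_eq_iff)
  hence n1: "(vnorm \<Psi>)\<^sup>2 = 1" unfolding \<Psi>_def unitary_vnorm[OF U \<psi>c] .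
  have "dim_vec \<Psi> = ?D * ?D" using Uc by (simp add: \<Psi>_def N power_add)
  hence total: "(\<Sum>x<?D. \<Sum>z<?D. (cmod (\<Psi> $ (x * ?D + z)))\<^sup>2) = 1"
    using n1 by (simp add: vnorm_power2 sum_lessThan_mult)
  have "\<exists>x<?D. 1 / real ?D \<le> (\<Sum>z<?D. (cmod (\<Psi> $ (x * ?D + z)))\<^sup>2)"
  proof (rule ccontr)
    assume "\<not> ?thesis"
    hence "(\<Sum>x<?D. \<Sum>z<?D. (cmod (\<Psi> $ (x * ?D + z)))\<^sup>2) < (\<Sum>x<?D. 1 / real ?D)"
      using d_pos by (intro sum_strict_mono) (auto simp: not_le lessThan_empty_iff)
    thus False unfolding total using d_pos by simp
  qed
  then obtain x where x: "x < ?D" "1 / real ?D \<le> (\<Sum>z<?D. (cmod (\<Psi> $ (x * ?D + z)))\<^sup>2)" by blast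
  let ?u = "unit_vec ?D x :: complex vec"
  have hN: "N div 2 = h" using N by simp
  have u: "(\<Sum>y<?D. f y * cnj (?u $ y)) = f x" for f
  proof -
    have "(\<Sum>y<?D. f y * cnj (?u $ y)) = (\<Sum>y<?D. if y = x then f y else 0)"
      using x by (intro sum.cong) auto
    thus ?thesis using x by simp
  qed
  have "(vnorm ?u)\<^sup>2 = (\<Sum>y<?D. if y = x then 1 else 0)"
    unfolding vnorm_power2 using x by (intro sum.cong) auto
  also have "\<dots> = 1" using x by simp
  finally have un: "vnorm ?u = 1" using vnorm_nonneg[of ?u] by (simp add: power2_eq_1_iff)
  have "renyi b \<alpha> (trace_B d N (?U * ket_bra \<psi> * mat_adjoint ?U)) \<le> \<alpha> / (\<alpha> - 1) * log b (1 / (1 / real ?D))"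
  proof (rule renyi_rho_A_le[OF _ Uc \<psi>c _ un[folded hN]])
    show "1 / real ?D \<le> (\<Sum>z<d ^ (N div 2). (cmod (\<Sum>y<d ^ (N div 2).
        (?U *\<^sub>v \<psi>) $ (y * d ^ (N div 2) + z) * cnj (unit_vec (d ^ (N div 2)) x $ y)))\<^sup>2)"
      unfolding hN u \<Psi>_def[symmetric] by (rule x)
  qed (use N d_pos b \<alpha> in auto)
  thus "\<psi> \<in> {\<psi>. renyi b \<alpha> (rho_A d (N, G) t \<psi>) \<le> \<alpha> / (\<alpha> - 1) * log b (real d ^ h)}"
    by (simp add: rho_A_def)
qed

end

section \<open>Choice of the constants\<close>

lemma poly_le_power:
  fixes p :: "real poly"
  assumes "1 \<le> x"
  shows "poly p x \<le> (\<Sum>i\<le>degree p. \<bar>coeff p i\<bar>) * x ^ degree p"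
proof -
  have "coeff p i * x ^ i \<le> \<bar>coeff p i\<bar> * x ^ degree p" if "i \<le> degree p" for i
    using assms that by (intro mult_mono power_increasing) auto
  thus ?thesis unfolding poly_altdef sum_distrib_right by (intro sum_mono) auto
qed

theorem theorem1:
  fixes d :: nat and b :: real and c x0 :: "real \<Rightarrow> real" and p :: "real poly"
  assumes "2 \<le> d" and "1 < b"
    and "\<forall>t::nat. 1 \<le> t \<longrightarrow> 0 < poly p (real t)"
  shows "\<exists>M>0. \<exists>t0>0. \<forall>(F :: circuit set) e.
    (\<forall>C\<in>F. charge_conserving_circuit d C) \<longrightarrow>
    no_faster_than_diffusive d F c x0 \<longrightarrow>
    X_eigenbasis d e \<longrightarrow>
    (\<forall>C\<in>F. \<forall>\<alpha>>1. \<forall>t::nat. t0 < real t \<longrightarrow>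
       measure_pmf.prob (random_X_state d (fst C) e)
         {\<psi>. renyi b \<alpha> (rho_A d C t \<psi>) \<le> \<alpha> / (\<alpha> - 1) * M * sqrt (real t * log b (real t))}
       \<ge> 1 - 1 / poly p (real t))"
proof (cases "0 < c (1/4)")
  case False
  \<comment> \<open>Without a positive constant at \<open>1/4\<close> no family satisfies the
    transport condition, and any positive \<open>M\<close> and \<open>t0\<close> will do.\<close>
  have "\<not> no_faster_than_diffusive d F c x0" for F
    using False by (auto simp: no_faster_than_diffusive_def intro!: exI[of _ "1/4"])
  thus ?thesis by (simp add: gt_ex)
next
  case c: True
  define n where "n = degree p"
  define A where "A = (\<Sum>i\<le>n. \<bar>coeff p i\<bar>)"
  \<comment> \<open>Chosen so that \<open>k\<close> of size \<open>K * sqrt (t * ln t)\<close> makes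
    the exponential error at most \<open>t\<close> to the power \<open>-(n + 3)\<close>.\<close>
  define K where "K = sqrt ((real n + 3) / (4 * c (1/4)))"
  \<comment> \<open>Covers \<open>log b (4 * d ^ (2 * k))\<close> divided by \<open>S\<close>, using
    \<open>k \<le> K * S + 3\<close> and \<open>1 \<le> S\<close>; the factor
    \<open>sqrt (ln b)\<close> converts the natural logarithm in \<open>S\<close> to base
    \<open>b\<close>.\<close>
  define M where "M = (log b 4 + (2 * K + 6) * log b (real d)) * sqrt (ln b)"
  \<comment> \<open>The summand 3 ensures \<open>1 \<le> ln t\<close>, \<open>32 * A\<close> absorbs
    the constants of the error probability, and the exponential puts
    \<open>(2 * k)\<^sup>2 / t\<close> above \<open>x0 (1/4)\<close>.\<close>
  define t0 where "t0 = 3 + 32 * A + exp (\<bar>x0 (1/4)\<bar> / (4 * K\<^sup>2))"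
  have K: "0 < K" "K\<^sup>2 = (real n + 3) / (4 * c (1/4))" using c by (auto simp: K_def)
  have A: "0 \<le> A" by (auto simp: A_def)
  have logs: "0 < log b 4" "0 < log b (real d)" using assms(1,2) by auto
  have "0 < log b 4 + (2 * K + 6) * log b (real d)" using logs K by (intro add_pos_pos mult_pos_pos) auto
  hence M: "0 < M" using assms(2) by (simp add: M_def)
  have t0: "0 < t0" using A by (simp add: t0_def add_pos_pos)
  have main: "measure_pmf.prob (random_X_state d N e)
      {\<psi>. renyi b \<alpha> (rho_A d (N, G) t \<psi>) \<le> \<alpha> / (\<alpha> - 1) * M * sqrt (real t * log b (real t))}
       \<ge> 1 - 1 / poly p (real t)"
    if circuit: "charge_conserving_circuit d (N, G)" and F: "(N, G) \<in> F"
      and diffusive: "no_faster_than_diffusive d F c x0" and e: "X_eigenbasis d e"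
      and \<alpha>: "1 < \<alpha>" and t: "t0 < real t" for F e N G \<alpha> and t :: nat
  proof -
    define h where "h = N div 2"
    have "N = h + h" using circuit by (auto simp: charge_conserving_circuit_def h_def elim!: evenE)
    then interpret cut_chain d N h G using assms(1) circuit by unfold_locales
    define S where "S = sqrt (real t * ln (real t))"
    \<comment> \<open>The added 2 guarantees \<open>2 \<le> k\<close>.\<close>
    define k where "k = nat \<lceil>K * S\<rceil> + 2"
    have "0 < exp (\<bar>x0 (1/4)\<bar> / (4 * K\<^sup>2))" by simp
    hence t3: "3 \<le> real t" and t32: "32 * A \<le> real t" and tx: "exp (\<bar>x0 (1/4)\<bar> / (4 * K\<^sup>2)) < real t"
      using t A unfolding t0_def by linarith+
    have "exp 1 \<le> real t" using exp_le t3 by linarith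
    hence lnt: "1 \<le> ln (real t)" using t3 by (simp add: ln_ge_iff)
    have "1 * 1 \<le> real t * ln (real t)" using lnt t3 by (intro mult_mono) auto
    hence S1: "1 \<le> S" by (simp add: S_def)
    have S2: "S\<^sup>2 = real t * ln (real t)" using lnt t3 by (simp add: S_def)
    have KS: "0 < K * S" using K S1 by simp
    have k: "K * S \<le> real k" "real k \<le> K * S + 3" "2 \<le> k"
      using KS unfolding k_def by linarith+
    have k2: "4 * K\<^sup>2 * ln (real t) \<le> (real (2 * k))\<^sup>2 / real t"
    proof -
      have "(K * S)\<^sup>2 \<le> (real k)\<^sup>2" using k(1) KS by (intro power_mono) auto
      thus ?thesis using t3 by (simp add: field_simps power_mult_distrib S2)
    qed
    let ?R = "\<alpha> / (\<alpha> - 1) * M * sqrt (real t * log b (real t))"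
    have R: "\<alpha> / (\<alpha> - 1) * log b (4 * real d ^ (2 * k)) \<le> ?R"
    proof -
      have "log b (4 * real d ^ (2 * k)) = log b 4 + 2 * real k * log b (real d)"
        using d_pos by (simp add: log_mult log_nat_power)
      also have "\<dots> \<le> log b 4 * S + (2 * K * S + 6 * S) * log b (real d)"
        using logs S1 k(2) by (intro add_mono mult_right_mono) auto
      also have "\<dots> = (log b 4 + (2 * K + 6) * log b (real d)) * S" by (simp add: algebra_simps)
      also have "S = sqrt (ln b) * sqrt (real t * log b (real t))"
        using assms(2) t3 lnt by (simp add: S_def log_def real_sqrt_mult[symmetric])
      finally have "log b (4 * real d ^ (2 * k)) \<le> M * sqrt (real t * log b (real t))"
        by (simp add: M_def mult.assoc)
      from mult_left_mono[OF this, of "\<alpha> / (\<alpha> - 1)"] show ?thesis using \<alpha> by (simp add: mult.assoc)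
    qed
    have p: "0 < poly p (real t)" using assms(3) t3 by simp
    show ?thesis
    proof (cases "k \<le> h")
      case True
      have "\<bar>x0 (1/4)\<bar> / (4 * K\<^sup>2) < ln (real t)" 
        using tx t3 ln_less_cancel_iff[of "exp (\<bar>x0 (1/4)\<bar> / (4 * K\<^sup>2))" "real t"] by simp
      hence "\<bar>x0 (1/4)\<bar> < 4 * K\<^sup>2 * ln (real t)" using K(1) by (simp add: divide_less_eq mult.commute)
      hence large: "x0 (1/4) < (real (2 * k))\<^sup>2 / real t" using k2 by linarith
      let ?X = "c (1/4) * (real (2 * k))\<^sup>2 / real t"
      have "(real n + 3) * ln (real t) = c (1/4) * (4 * K\<^sup>2 * ln (real t))" using c by (simp add: K(2))
      also have "\<dots> \<le> ?X" using mult_left_mono[OF k2, of "c (1/4)"] c by simp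
      finally have "exp ((real n + 3) * ln (real t)) \<le> exp ?X" by simp
      also have "exp ((real n + 3) * ln (real t)) = real t ^ (n + 3)"
        using t3 exp_of_nat_mult[of "n + 3" "ln (real t)"] by simp
      \<comment> \<open>Of the exponent \<open>n + 3\<close>, \<open>n\<close> pays for the
        polynomial, 2 for the factor \<open>t\<^sup>2\<close>, and 1 for the constant
        \<open>32 * A\<close>.\<close>
      finally have X: "real t ^ (n + 3) \<le> exp ?X" .
      have "32 * (real t)\<^sup>2 * poly p (real t) \<le> 32 * (real t)\<^sup>2 * (A * real t ^ n)"
        using poly_le_power[of "real t" p] t3 by (intro mult_left_mono) (auto simp: A_def n_def)
      also have "\<dots> = (32 * A) * real t ^ (n + 2)" by (simp add: power_add power2_eq_square)
      also have "\<dots> \<le> real t * real t ^ (n + 2)" using t32 by (intro mult_right_mono) auto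
      also have "\<dots> = real t ^ (n + 3)" by (simp add: numeral_3_eq_3)
      finally have "32 * (real t)\<^sup>2 * poly p (real t) \<le> exp ?X" using X by linarith
      hence "32 * (real t)\<^sup>2 * exp (- ?X) \<le> 1 / poly p (real t)"
        using p by (simp add: exp_minus field_simps)
      hence "1 - 1 / poly p (real t) \<le> 1 - 32 * (real t)\<^sup>2 * exp (- c (1/4) * (real (2 * k))\<^sup>2 / real t)"
        by simp
      also have "\<dots> \<le> measure_pmf.prob (random_X_state d N e)
          {\<psi>. renyi b \<alpha> (rho_A d (N, G) t \<psi>) \<le> \<alpha> / (\<alpha> - 1) * log b (4 * real d ^ (2 * k))}"
        by (rule prob_renyi_diffusive[OF diffusive F e k(3) True large assms(2) \<alpha>])
      also have "\<dots> \<le> measure_pmf.prob (random_X_state d N e)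
          {\<psi>. renyi b \<alpha> (rho_A d (N, G) t \<psi>) \<le> ?R}"
        using R by (intro measure_pmf.finite_measure_mono) auto
      finally show ?thesis .
    next
      case False
      \<comment> \<open>Here \<open>C\<close> does not fit into the chain, but then half the chain
        is so short that its dimension alone gives the bound, with probability 1.\<close>
      have "real d ^ h \<le> real d ^ (2 * k)" using False d_pos by (intro power_increasing) auto
      moreover have "0 \<le> real d ^ (2 * k)" by simp
      ultimately have "real d ^ h \<le> 4 * real d ^ (2 * k)" by linarith
      hence "log b (real d ^ h) \<le> log b (4 * real d ^ (2 * k))" using assms(2) d_pos by simp
      hence "\<alpha> / (\<alpha> - 1) * log b (real d ^ h) \<le> \<alpha> / (\<alpha> - 1) * log b (4 * real d ^ (2 * k))"
        using \<alpha> by (intro mult_left_mono) auto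
      with R have "\<alpha> / (\<alpha> - 1) * log b (real d ^ h) \<le> ?R" by linarith
      hence "measure_pmf.prob (random_X_state d N e)
            {\<psi>. renyi b \<alpha> (rho_A d (N, G) t \<psi>) \<le> \<alpha> / (\<alpha> - 1) * log b (real d ^ h)} \<le>
          measure_pmf.prob (random_X_state d N e) {\<psi>. renyi b \<alpha> (rho_A d (N, G) t \<psi>) \<le> ?R}"
        by (intro measure_pmf.finite_measure_mono) auto
      moreover have "1 - 1 / poly p (real t) \<le> 1" using p by simp
      ultimately show ?thesis unfolding prob_renyi_dimension[OF e assms(2) \<alpha>] by linarith
    qed
  qed
  show ?thesis
  proof (rule exI[of _ M], intro conjI M, rule exI[of _ t0], intro conjI t0 allI impI ballI)
    fix F :: "circuit set" and e C and \<alpha> :: real and t :: nat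
    assume "\<forall>C\<in>F. charge_conserving_circuit d C" "no_faster_than_diffusive d F c x0" "X_eigenbasis d e"
      "C \<in> F" "1 < \<alpha>" "t0 < real t"
    thus "1 - 1 / poly p (real t) \<le> measure_pmf.prob (random_X_state d (fst C) e)
        {\<psi>. renyi b \<alpha> (rho_A d C t \<psi>) \<le> \<alpha> / (\<alpha> - 1) * M * sqrt (real t * log b (real t))}"
      using main[of "fst C" "snd C" F e \<alpha> t] by simp
  qed
qed

end
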